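(* Let $\Gamma$ be a finite simplicial graph with vertex set $V$, and let $X$ be the compact nonpositively curved cube complex $G'\backslash\widetilde X$, where $\widetilde X$ is the Davis complex of the right-angled Coxeter group $G(\Gamma)$ and $G'$ is the kernel of the abelianization homomorphism $\alpha: G(\Gamma)\to\mathbb{Z}_2^V$. Suppose there is a system of moves $m: V\to 2^V$, $v\mapsto m_v$, for $\Gamma$ with a legal orbit. Then there is a diagonal map $\phi: X\to S^1$ such that for every $0$-cube $x$ of $X$ the ascending link and the descending link of $x$ are nonempty and connected.
   Context: Let $\Gamma=\Gamma(V,E)$ be a simplicial graph. A state is a subset $S\subset V$; it is legal if the subgraphs of $\Gamma$ induced by $S$ and by $V-S$ are both nonempty and connected. A move at $v\in V$ is a subset $m_v\subset V$ with $v\in m_v$ and $u\notin m_v$ whenever $\{u,v\}\in E$. A system of moves is a choice of a move $m_v$ for each $v\in V$ (the $m_v$ need not be distinct). Identify $2^V$ with the group $\mathbb{Z}_2^V$ (multiplication is symmetric difference), and let $M\le \mathbb{Z}_2^V$ be the subgroup generated by the moves; $M$ acts on the set of states by symmetric difference. A legal orbit is an $M$-orbit all of whose elements are legal states. $G(\Gamma)$ is the right-angled Coxeter group with generators $v\in V$ and relations $v^2=1$ for $v\in V$ and $uv=vu$ for $\{u,v\}\in E$. Its Davis complex $\widetilde X$ is the CAT(0) cube complex whose $1$-skeleton is the Cayley graph of $G(\Gamma)$ with each bigon identified to an edge, and with $n$-cubes added equivariantly for each collection of $n$ pairwise commuting generators. The homomorphism $\alpha: G(\Gamma)\to\mathbb{Z}_2^V$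 is induced by $v\mapsto\{v\}$. A diagonal map $[0,1]^d\to S^1$ on a $d$-cube is the restriction of a composition $\mathbb{R}^d\to\mathbb{R}\to S^1=\mathbb{R}/\mathbb{Z}$, where the first map is linear of the form $(x_1,\dots,x_d)\mapsto\sum_i\pm x_i$ and the second is the quotient map. A diagonal map on a cube complex is a map to $S^1$ whose restriction to each cube is a diagonal map. Let $\tilde\phi:\widetilde X\to\mathbb{R}$ be a lift of $\phi$. A $(d-1)$-simplex of $\mathrm{link}(x)$ is ascending (resp. descending) if the restriction of $\tilde\phi$ to the corresponding $d$-cube has a minimum (resp. maximum) at (a lift of) $x$. The ascending (resp. descending) link of $x$ is the subcomplex of $\mathrm{link}(x)$ consisting of all ascending (resp. descending) vertices and edges. *)

theory Defs
  imports
    "HOL-Analysis.Analysis"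
    "HOL-Algebra.Generated_Groups"
    "Graph_Theory.Pair_Digraph"
    "Graph_Theory.Digraph_Component"
begin

text \<open>
  A finite simplicial graph is a \<open>pair_graph\<close>: a finite set of vertices with a symmetric, loop-free
  adjacency relation \<open>parcs\<close>.  The name \<open>connected\<close> is also the topological notion of HOL-Analysis,
  hence the abbreviation.
\<close>

abbreviation graph_connected :: "('a, 'b) pre_digraph \<Rightarrow> bool" where
  "graph_connected \<equiv> Digraph_Component.connected"


section \<open>States, moves and legal orbits\<close>

definition Z2_power :: "'v set \<Rightarrow> 'v set monoid" where
  "Z2_power V = \<lparr>carrier = Pow V, mult = (\<lambda>A B. sym_diff A B), one = {}\<rparr>"

definition legal_state :: "'v pair_pre_digraph \<Rightarrow> 'v set \<Rightarrow> bool" where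
  "legal_state \<Gamma> S \<longleftrightarrow> S \<subseteq> pverts \<Gamma> \<and>
     S \<noteq> {} \<and> graph_connected (induce_subgraph (with_proj \<Gamma>) S) \<and>
     pverts \<Gamma> - S \<noteq> {} \<and> graph_connected (induce_subgraph (with_proj \<Gamma>) (pverts \<Gamma> - S))"

definition is_move :: "'v pair_pre_digraph \<Rightarrow> 'v \<Rightarrow> 'v set \<Rightarrow> bool" where
  "is_move \<Gamma> v A \<longleftrightarrow> A \<subseteq> pverts \<Gamma> \<and> v \<in> A \<and> (\<forall>u. (u, v) \<in> parcs \<Gamma> \<longrightarrow> u \<notin> A)"

definition system_of_moves :: "'v pair_pre_digraph \<Rightarrow> ('v \<Rightarrow> 'v set) \<Rightarrow> bool" where
  "system_of_moves \<Gamma> m \<longleftrightarrow> (\<forall>v\<in>pverts \<Gamma>. is_move \<Gamma> v (m v))"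

definition move_group :: "'v pair_pre_digraph \<Rightarrow> ('v \<Rightarrow> 'v set) \<Rightarrow> 'v set set" where
  "move_group \<Gamma> m = generate (Z2_power (pverts \<Gamma>)) (m ` pverts \<Gamma>)"

definition state_orbit :: "'v pair_pre_digraph \<Rightarrow> ('v \<Rightarrow> 'v set) \<Rightarrow> 'v set \<Rightarrow> 'v set set" where
  "state_orbit \<Gamma> m S = (\<lambda>A. sym_diff A S) ` move_group \<Gamma> m"

definition legal_orbit :: "'v pair_pre_digraph \<Rightarrow> ('v \<Rightarrow> 'v set) \<Rightarrow> 'v set set \<Rightarrow> bool" where
  "legal_orbit \<Gamma> m Orb \<longleftrightarrow>
     (\<exists>S\<subseteq>pverts \<Gamma>. Orb = state_orbit \<Gamma> m S) \<and> (\<forall>T\<in>Orb. legal_state \<Gamma> T)"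


section \<open>Groups given by generators and relations\<close>

text \<open>The letter \<open>(x, True)\<close> stands for the generator \<open>x\<close> and \<open>(x, False)\<close> for its inverse.\<close>

type_synonym 'a word = "('a \<times> bool) list"

abbreviation words :: "'a set \<Rightarrow> 'a word set" where
  "words X \<equiv> lists (X \<times> UNIV)"

inductive presented_eq :: "'a set \<Rightarrow> ('a word \<times> 'a word) set \<Rightarrow> 'a word \<Rightarrow> 'a word \<Rightarrow> bool"
  for X :: "'a set" and R :: "('a word \<times> 'a word) set" where
  refl: "w \<in> words X \<Longrightarrow> presented_eq X R w w"
| sym: "presented_eq X R u w \<Longrightarrow> presented_eq X R w u"
| trans: "presented_eq X R u v \<Longrightarrow> presented_eq X R v w \<Longrightarrow> presented_eq X R u w"
| append: "presented_eq X R u v \<Longrightarrow> presented_eq X R u' v' \<Longrightarrow> presented_eq X R (u @ u') (v @ v')"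
| cancel: "x \<in> X \<Longrightarrow> presented_eq X R [(x, b), (x, \<not> b)] []"
| relation: "(u, v) \<in> R \<Longrightarrow> u \<in> words X \<Longrightarrow> v \<in> words X \<Longrightarrow> presented_eq X R u v"

definition word_class :: "'a set \<Rightarrow> ('a word \<times> 'a word) set \<Rightarrow> 'a word \<Rightarrow> 'a word set" where
  "word_class X R u = {w. presented_eq X R u w}"

definition presented_group :: "'a set \<Rightarrow> ('a word \<times> 'a word) set \<Rightarrow> 'a word set monoid" where
  "presented_group X R =
     \<lparr>carrier = word_class X R ` words X,
      mult = (\<lambda>A B. \<Union>a\<in>A. \<Union>b\<in>B. word_class X R (a @ b)),
      one = word_class X R []\<rparr>"

lemma presented_eq_words:
  "presented_eq X R u w \<Longrightarrow> u \<in> words X \<and> w \<in> words X"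
  by (induction rule: presented_eq.induct) auto

lemma word_class_eq_iff:
  assumes "u \<in> words X"
  shows "word_class X R u = word_class X R w \<longleftrightarrow> presented_eq X R u w"
proof
  assume "word_class X R u = word_class X R w"
  then have "u \<in> word_class X R w"
    using presented_eq.refl[OF assms] by (auto simp: word_class_def)
  then show "presented_eq X R u w"
    by (auto simp: word_class_def intro: presented_eq.sym)
next
  assume uw: "presented_eq X R u w"
  have "presented_eq X R u v \<longleftrightarrow> presented_eq X R w v" for v
    using presented_eq.trans[OF uw, of v] presented_eq.trans[OF presented_eq.sym[OF uw], of v]
    by (rule iffI[rotated])
  then show "word_class X R u = word_class X R w"
    by (simp add: word_class_def)
qed

lemma word_class_mult:
  assumes "u \<in> words X" "w \<in> words X"
  shows "word_class X R u \<otimes>\<^bsub>presented_group X R\<^esub> word_class X R w = word_class X R (u @ w)"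
proof -
  have *: "word_class X R (a @ b) = word_class X R (u @ w)"
    if "a \<in> word_class X R u" "b \<in> word_class X R w" for a b
  proof -
    have "presented_eq X R (u @ w) (a @ b)"
      using that unfolding word_class_def by (intro presented_eq.append) simp_all
    moreover have "u @ w \<in> words X" using assms by simp
    ultimately show ?thesis
      by (metis word_class_eq_iff)
  qed
  have uw: "u \<in> word_class X R u" "w \<in> word_class X R w"
    using presented_eq.refl[OF assms(1)] presented_eq.refl[OF assms(2)]
    by (simp_all only: word_class_def mem_Collect_eq)
  have "(\<Union>a\<in>word_class X R u. \<Union>b\<in>word_class X R w. word_class X R (a @ b))
      = (\<Union>a\<in>word_class X R u. \<Union>b\<in>word_class X R w. word_class X R (u @ w))"
    by (intro SUP_cong HOL.refl *)
  also have "\<dots> = word_class X R (u @ w)"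
  proof -
    have "word_class X R u \<noteq> {}" "word_class X R w \<noteq> {}" using uw by (metis empty_iff)+
    then show ?thesis by (simp only: UN_constant if_False)
  qed
  finally show ?thesis
    by (simp only: presented_group_def monoid.simps)
qed

lemma presented_eq_inverse:
  "w \<in> words X \<Longrightarrow> presented_eq X R (map (\<lambda>(x, b). (x, \<not> b)) (rev w) @ w) []"
proof (induction w)
  case Nil
  show ?case by (simp add: presented_eq.refl)
next
  case (Cons l w)
  obtain x b where l: "l = (x, b)" by (cases l)
  let ?w' = "map (\<lambda>(x, b). (x, \<not> b)) (rev w)"
  have xX: "x \<in> X" and w: "w \<in> words X" using Cons.prems l by auto
  have w': "?w' \<in> words X" using w by (auto simp: lists_eq_set)
  have "presented_eq X R [(x, \<not> b), (x, \<not> \<not> b)] []"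
    by (rule presented_eq.cancel[OF xX])
  then have "presented_eq X R (?w' @ [(x, \<not> b), (x, b)] @ w) (?w' @ [] @ w)"
    by (intro presented_eq.append presented_eq.refl w w') simp
  then show ?case
    using presented_eq.trans[OF _ Cons.IH[OF w]] by (simp add: l)
qed

lemma group_presented_group: "group (presented_group X R)"
proof (rule groupI)
  let ?G = "presented_group X R"
  have car: "carrier ?G = word_class X R ` words X" and one: "\<one>\<^bsub>?G\<^esub> = word_class X R []"
    by (simp_all add: presented_group_def)
  fix x y assume x: "x \<in> carrier ?G" and y: "y \<in> carrier ?G"
  from x obtain u where u: "u \<in> words X" "x = word_class X R u" unfolding car by blast
  from y obtain v where v: "v \<in> words X" "y = word_class X R v" unfolding car by blast
  show "x \<otimes>\<^bsub>?G\<^esub> y \<in> carrier ?G"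
    using u v by (auto simp: word_class_mult car)
  fix z assume "z \<in> carrier ?G"
  then obtain w where w: "w \<in> words X" "z = word_class X R w" unfolding car by blast
  show "x \<otimes>\<^bsub>?G\<^esub> y \<otimes>\<^bsub>?G\<^esub> z = x \<otimes>\<^bsub>?G\<^esub> (y \<otimes>\<^bsub>?G\<^esub> z)"
    using u v w by (simp add: word_class_mult)
next
  let ?G = "presented_group X R"
  have car: "carrier ?G = word_class X R ` words X" and one: "\<one>\<^bsub>?G\<^esub> = word_class X R []"
    by (simp_all add: presented_group_def)
  show "\<one>\<^bsub>?G\<^esub> \<in> carrier ?G" by (auto simp: car one)
  fix x assume "x \<in> carrier ?G"
  then obtain u where u: "u \<in> words X" "x = word_class X R u" unfolding car by blast
  show "\<one>\<^bsub>?G\<^esub> \<otimes>\<^bsub>?G\<^esub> x = x" using u by (simp add: one word_class_mult)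
  let ?u' = "map (\<lambda>(x, b). (x, \<not> b)) (rev u)"
  have u': "?u' \<in> words X" using u by (auto simp: lists_eq_set)
  have "word_class X R ?u' \<otimes>\<^bsub>?G\<^esub> x = \<one>\<^bsub>?G\<^esub>"
    using u u' presented_eq_inverse[of u X R] word_class_eq_iff[of "?u' @ u" X R "[]"]
    by (simp add: word_class_mult one)
  then show "\<exists>y\<in>carrier ?G. y \<otimes>\<^bsub>?G\<^esub> x = \<one>\<^bsub>?G\<^esub>" using u' car by blast
qed


section \<open>The right-angled Coxeter group and its abelianization\<close>

definition racg_relations :: "'v pair_pre_digraph \<Rightarrow> ('v word \<times> 'v word) set" where
  "racg_relations \<Gamma> =
     {([(v, True), (v, True)], []) | v. v \<in> pverts \<Gamma>} \<union>
     {([(u, True), (v, True)], [(v, True), (u, True)]) | u v. (u, v) \<in> parcs \<Gamma>}"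

definition racg :: "'v pair_pre_digraph \<Rightarrow> 'v word set monoid" where
  "racg \<Gamma> = presented_group (pverts \<Gamma>) (racg_relations \<Gamma>)"

definition racg_gen :: "'v pair_pre_digraph \<Rightarrow> 'v \<Rightarrow> 'v word set" where
  "racg_gen \<Gamma> v = word_class (pverts \<Gamma>) (racg_relations \<Gamma>) [(v, True)]"

definition word_parity :: "'v word \<Rightarrow> 'v set" where
  "word_parity w = {v. odd (length (filter (\<lambda>l. fst l = v) w))}"

text \<open>The value on any representing word; \<open>racg_abel_hom\<close> and \<open>racg_abel_gen\<close> below show that
  this is the homomorphism induced by \<open>v \<mapsto> {v}\<close>.\<close>

definition racg_abel :: "'v word set \<Rightarrow> 'v set" where
  "racg_abel g = the_elem (word_parity ` g)"

definition racg_kernel :: "'v pair_pre_digraph \<Rightarrow> 'v word set set" where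
  "racg_kernel \<Gamma> = kernel (racg \<Gamma>) (Z2_power (pverts \<Gamma>)) racg_abel"

lemma word_parity_append: "word_parity (u @ w) = sym_diff (word_parity u) (word_parity w)"
  by (auto simp: word_parity_def)

lemma word_parity_Nil: "word_parity [] = {}"
  by (simp add: word_parity_def)

lemma word_parity_Cons: "word_parity (l # w) = sym_diff {fst l} (word_parity w)"
  by (auto simp: word_parity_def)

lemma word_parity_racg_eq:
  "presented_eq (pverts \<Gamma>) (racg_relations \<Gamma>) u w \<Longrightarrow> word_parity u = word_parity w"
proof (induction rule: presented_eq.induct)
  case (relation u v)
  then consider x where "u = [(x, True), (x, True)]" "v = []"
    | x y where "u = [(x, True), (y, True)]" "v = [(y, True), (x, True)]"
    by (auto simp: racg_relations_def)
  then show ?case by cases (simp_all add: word_parity_Nil word_parity_Cons Un_commute)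
qed (simp_all add: word_parity_append word_parity_Nil word_parity_Cons)

lemma racg_abel_word_class:
  assumes "w \<in> words (pverts \<Gamma>)"
  shows "racg_abel (word_class (pverts \<Gamma>) (racg_relations \<Gamma>) w) = word_parity w"
proof -
  have "word_parity ` word_class (pverts \<Gamma>) (racg_relations \<Gamma>) w = {word_parity w}"
  proof (intro equalityI subsetI)
    fix A assume "A \<in> word_parity ` word_class (pverts \<Gamma>) (racg_relations \<Gamma>) w"
    then show "A \<in> {word_parity w}"
      using word_parity_racg_eq[of \<Gamma> w] by (auto simp: word_class_def)
  next
    fix A assume "A \<in> {word_parity w}"
    then show "A \<in> word_parity ` word_class (pverts \<Gamma>) (racg_relations \<Gamma>) w"
      using presented_eq.refl[OF assms] by (simp add: word_class_def image_iff) blast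
  qed
  then show ?thesis by (simp add: racg_abel_def)
qed

lemma racg_abel_hom: "racg_abel \<in> hom (racg \<Gamma>) (Z2_power (pverts \<Gamma>))"
proof (rule homI)
  let ?c = "word_class (pverts \<Gamma>) (racg_relations \<Gamma>)"
  have car: "carrier (racg \<Gamma>) = ?c ` words (pverts \<Gamma>)"
    by (simp add: racg_def presented_group_def)
  have par: "word_parity w \<subseteq> pverts \<Gamma>" if "w \<in> words (pverts \<Gamma>)" for w
  proof
    fix v assume "v \<in> word_parity w"
    then have "filter (\<lambda>l. fst l = v) w \<noteq> []" by (auto simp: word_parity_def)
    then obtain l where "l \<in> set w" "fst l = v" by (auto simp: filter_empty_conv)
    then show "v \<in> pverts \<Gamma>" using that by (auto simp: lists_eq_set)
  qed
  fix x assume "x \<in> carrier (racg \<Gamma>)"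
  then obtain u where u: "u \<in> words (pverts \<Gamma>)" "x = ?c u" unfolding car by blast
  show "racg_abel x \<in> carrier (Z2_power (pverts \<Gamma>))"
    using u par[of u] by (simp add: racg_abel_word_class Z2_power_def)
  fix y assume "y \<in> carrier (racg \<Gamma>)"
  then obtain w where w: "w \<in> words (pverts \<Gamma>)" "y = ?c w" unfolding car by blast
  have "x \<otimes>\<^bsub>racg \<Gamma>\<^esub> y = ?c (u @ w)"
    using u w by (simp add: racg_def word_class_mult)
  moreover have "u @ w \<in> words (pverts \<Gamma>)" using u w by simp
  ultimately show "racg_abel (x \<otimes>\<^bsub>racg \<Gamma>\<^esub> y)
      = racg_abel x \<otimes>\<^bsub>Z2_power (pverts \<Gamma>)\<^esub> racg_abel y"
    using u w by (simp add: racg_abel_word_class word_parity_append Z2_power_def)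
qed

lemma racg_abel_gen:
  assumes "v \<in> pverts \<Gamma>"
  shows "racg_abel (racg_gen \<Gamma> v) = {v}"
proof -
  have "[(v, True)] \<in> words (pverts \<Gamma>)" using assms by simp
  from racg_abel_word_class[OF this] show ?thesis
    by (simp add: racg_gen_def word_parity_Nil word_parity_Cons)
qed


section \<open>Cube complexes\<close>

text \<open>
  \<open>unit_cube C\<close> is the cube with coordinates indexed by \<open>C\<close>; the coordinates outside \<open>C\<close> are set to
  zero, so that \<open>unit_cube D\<close> is a face of \<open>unit_cube C\<close> when \<open>D \<subseteq> C\<close>.

  A cube complex is represented by its characteristic maps: a chart \<open>(C, \<kappa>)\<close> is a cube of dimension
  \<open>card C\<close> (\<open>C\<close> finite) with characteristic map \<open>\<kappa>\<close>, defined on \<open>unit_cube C\<close>.  The same cube may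
  have several charts.  The topology is the weak topology of the complex.
\<close>

definition unit_cube :: "'v set \<Rightarrow> ('v \<Rightarrow> real) set" where
  "unit_cube C = {t. (\<forall>v\<in>C. 0 \<le> t v \<and> t v \<le> 1) \<and> (\<forall>v. v \<notin> C \<longrightarrow> t v = 0)}"

type_synonym ('v, 'p) chart = "'v set \<times> (('v \<Rightarrow> real) \<Rightarrow> 'p)"

definition complex_points :: "('v, 'p) chart set \<Rightarrow> 'p set" where
  "complex_points K = (\<Union>(C, \<kappa>)\<in>K. \<kappa> ` unit_cube C)"

definition cubes :: "('v, 'p) chart set \<Rightarrow> nat \<Rightarrow> 'p set set" where
  "cubes K d = {\<kappa> ` unit_cube C | C \<kappa>. (C, \<kappa>) \<in> K \<and> card C = d}"

definition zero_cubes :: "('v, 'p) chart set \<Rightarrow> 'p set" where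
  "zero_cubes K = {x. {x} \<in> cubes K 0}"

definition complex_open :: "('v, 'p) chart set \<Rightarrow> 'p set \<Rightarrow> bool" where
  "complex_open K U \<longleftrightarrow> U \<subseteq> complex_points K \<and>
     (\<forall>(C, \<kappa>)\<in>K. openin (top_of_set (unit_cube C)) {t \<in> unit_cube C. \<kappa> t \<in> U})"

definition complex_topology :: "('v, 'p) chart set \<Rightarrow> 'p topology" where
  "complex_topology K = topology (complex_open K)"

lemma istopology_complex_open: "istopology (complex_open K)"
  unfolding istopology_def
proof (intro conjI allI impI)
  fix S T assume S: "complex_open K S" and T: "complex_open K T"
  show "complex_open K (S \<inter> T)"
    unfolding complex_open_def
  proof (intro conjI ballI, goal_cases)
    case 1
    then show ?case using S by (auto simp: complex_open_def)
  next
    case (2 c)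
    obtain C \<kappa> where c: "c = (C, \<kappa>)" by (cases c)
    have "{t \<in> unit_cube C. \<kappa> t \<in> S \<inter> T} = {t \<in> unit_cube C. \<kappa> t \<in> S} \<inter> {t \<in> unit_cube C. \<kappa> t \<in> T}"
      by auto
    then show ?case using S T 2 c by (auto simp: complex_open_def intro!: openin_Int)
  qed
next
  fix \<K> assume K: "\<forall>S\<in>\<K>. complex_open K S"
  show "complex_open K (\<Union>\<K>)"
    unfolding complex_open_def
  proof (intro conjI ballI, goal_cases)
    case 1
    then show ?case using K by (auto simp: complex_open_def)
  next
    case (2 c)
    obtain C \<kappa> where c: "c = (C, \<kappa>)" by (cases c)
    have "{t \<in> unit_cube C. \<kappa> t \<in> \<Union>\<K>} = (\<Union>S\<in>\<K>. {t \<in> unit_cube C. \<kappa> t \<in> S})"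
      by auto
    then show ?case using K 2 c by (auto simp: complex_open_def intro!: openin_Union)
  qed
qed

text \<open>\<open>S\<^sup>1 = \<real>/\<int>\<close> is realised as the unit circle of the complex plane.\<close>

definition circle_quotient :: "real \<Rightarrow> complex" where
  "circle_quotient s = cis (2 * pi * s)"

definition diagonal_map :: "('v, 'p) chart set \<Rightarrow> ('p \<Rightarrow> complex) \<Rightarrow> bool" where
  "diagonal_map K \<phi> \<longleftrightarrow>
     (\<forall>(C, \<kappa>)\<in>K. \<exists>\<sigma> :: 'v \<Rightarrow> real. (\<forall>v\<in>C. \<sigma> v = 1 \<or> \<sigma> v = -1) \<and>
        (\<forall>t\<in>unit_cube C. \<phi> (\<kappa> t) = circle_quotient (\<Sum>v\<in>C. \<sigma> v * t v)))"


section \<open>The Davis complex and its quotient\<close>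

definition commuting_gens :: "'v pair_pre_digraph \<Rightarrow> 'v set \<Rightarrow> bool" where
  "commuting_gens \<Gamma> C \<longleftrightarrow> C \<subseteq> pverts \<Gamma> \<and>
     (\<forall>u\<in>C. \<forall>v\<in>C. racg_gen \<Gamma> u \<otimes>\<^bsub>racg \<Gamma>\<^esub> racg_gen \<Gamma> v = racg_gen \<Gamma> v \<otimes>\<^bsub>racg \<Gamma>\<^esub> racg_gen \<Gamma> u)"

text \<open>
  The pair \<open>(g, t)\<close> with \<open>t \<in> unit_cube C\<close>, where \<open>C\<close> is a set of pairwise commuting generators, is
  the point with coordinates \<open>t\<close> in the cube with vertices \<open>g \<cdot> \<Prod>D\<close> (\<open>D \<subseteq> C\<close>), when \<open>g\<close> is taken as
  the origin and the edge from \<open>g\<close> to \<open>g v\<close> as the axis of the coordinate \<open>v\<close>.  Two kinds of gluing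
  are needed: a face is glued to the cubes containing it, which is automatic as \<open>t\<close> vanishes
  outside \<open>C\<close>; and the same cube seen from \<open>g\<close> and from \<open>g v\<close> (\<open>v \<in> C\<close>) has its coordinate \<open>v\<close>
  reversed, which is \<open>davis_flip\<close>.  For \<open>C = {v}\<close> this identifies each bigon of the Cayley graph to
  one edge.
\<close>

definition davis_flip ::
    "'v pair_pre_digraph \<Rightarrow> (('v word set \<times> ('v \<Rightarrow> real)) \<times> ('v word set \<times> ('v \<Rightarrow> real))) set" where
  "davis_flip \<Gamma> =
     {((g, t), (g \<otimes>\<^bsub>racg \<Gamma>\<^esub> racg_gen \<Gamma> v, t(v := 1 - t v))) | g t v C.
        g \<in> carrier (racg \<Gamma>) \<and> commuting_gens \<Gamma> C \<and> v \<in> C \<and> t \<in> unit_cube C}"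

type_synonym 'v davis_pt = "('v word set \<times> ('v \<Rightarrow> real)) set"

definition davis_point ::
    "'v pair_pre_digraph \<Rightarrow> 'v word set \<Rightarrow> ('v \<Rightarrow> real) \<Rightarrow> 'v davis_pt" where
  "davis_point \<Gamma> g t = (davis_flip \<Gamma> \<union> (davis_flip \<Gamma>)\<inverse>)\<^sup>* `` {(g, t)}"

definition davis_complex :: "'v pair_pre_digraph \<Rightarrow> ('v, 'v davis_pt) chart set" where
  "davis_complex \<Gamma> =
     {(C, davis_point \<Gamma> g) | g C. g \<in> carrier (racg \<Gamma>) \<and> commuting_gens \<Gamma> C}"

definition davis_act ::
    "'v pair_pre_digraph \<Rightarrow> 'v word set \<Rightarrow> 'v davis_pt \<Rightarrow> 'v davis_pt" where
  "davis_act \<Gamma> h p = (\<lambda>(g, t). (h \<otimes>\<^bsub>racg \<Gamma>\<^esub> g, t)) ` p"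

text \<open>The covering projection to the quotient by the kernel of \<open>racg_abel\<close>: a point goes to its orbit.\<close>

definition davis_proj :: "'v pair_pre_digraph \<Rightarrow> 'v davis_pt \<Rightarrow> 'v davis_pt set" where
  "davis_proj \<Gamma> p = (\<lambda>h. davis_act \<Gamma> h p) ` racg_kernel \<Gamma>"

definition quotient_complex :: "'v pair_pre_digraph \<Rightarrow> ('v, 'v davis_pt set) chart set" where
  "quotient_complex \<Gamma> = {(C, davis_proj \<Gamma> \<circ> \<kappa>) | C \<kappa>. (C, \<kappa>) \<in> davis_complex \<Gamma>}"

lemma davis_act_point:
  assumes h: "h \<in> carrier (racg \<Gamma>)" and g: "g \<in> carrier (racg \<Gamma>)"
  shows "davis_act \<Gamma> h (davis_point \<Gamma> g t) = davis_point \<Gamma> (h \<otimes>\<^bsub>racg \<Gamma>\<^esub> g) t"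
proof -
  interpret G: group "racg \<Gamma>" by (simp add: racg_def group_presented_group)
  let ?R = "davis_flip \<Gamma> \<union> (davis_flip \<Gamma>)\<inverse>"
  let ?f = "\<lambda>k (g, t). (k \<otimes>\<^bsub>racg \<Gamma>\<^esub> g, t)"
  have gen: "racg_gen \<Gamma> v \<in> carrier (racg \<Gamma>)" if "v \<in> pverts \<Gamma>" for v
    using that by (auto simp: racg_gen_def racg_def presented_group_def)
  have car: "fst a \<in> carrier (racg \<Gamma>) \<and> fst b \<in> carrier (racg \<Gamma>)" if "(a, b) \<in> ?R" for a b
    using that gen by (auto simp: davis_flip_def commuting_gens_def)
  have flip: "(?f k a, ?f k b) \<in> davis_flip \<Gamma>"
    if "(a, b) \<in> davis_flip \<Gamma>" "k \<in> carrier (racg \<Gamma>)" for a b k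
  proof -
    obtain g t v C where *: "a = (g, t)" "b = (g \<otimes>\<^bsub>racg \<Gamma>\<^esub> racg_gen \<Gamma> v, t(v := 1 - t v))"
      "g \<in> carrier (racg \<Gamma>)" "commuting_gens \<Gamma> C" "v \<in> C" "t \<in> unit_cube C"
      using \<open>(a, b) \<in> davis_flip \<Gamma>\<close> unfolding davis_flip_def by blast
    have "v \<in> pverts \<Gamma>" using * by (auto simp: commuting_gens_def)
    then have "k \<otimes>\<^bsub>racg \<Gamma>\<^esub> (g \<otimes>\<^bsub>racg \<Gamma>\<^esub> racg_gen \<Gamma> v) = (k \<otimes>\<^bsub>racg \<Gamma>\<^esub> g) \<otimes>\<^bsub>racg \<Gamma>\<^esub> racg_gen \<Gamma> v"
      using G.m_assoc * that gen by simp
    then show ?thesis using * that unfolding davis_flip_def by auto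
  qed
  have shift: "(?f k a, ?f k b) \<in> ?R" if "(a, b) \<in> ?R" "k \<in> carrier (racg \<Gamma>)" for a b k
    using that flip[of a b k] flip[of b a k] by blast
  have star: "(?f k a, ?f k b) \<in> ?R\<^sup>* \<and> fst b \<in> carrier (racg \<Gamma>)"
    if "(a, b) \<in> ?R\<^sup>*" "k \<in> carrier (racg \<Gamma>)" "fst a \<in> carrier (racg \<Gamma>)" for a b k
    using that(1)
  proof (induction rule: rtrancl_induct)
    case base
    then show ?case using that by blast
  next
    case (step y z)
    have "(?f k y, ?f k z) \<in> ?R" using shift[OF step.hyps(2) that(2)] .
    moreover have "fst z \<in> carrier (racg \<Gamma>)" using car[OF step.hyps(2)] by (rule conjunct2)
    ultimately show ?case using step.IH rtrancl_into_rtrancl by (metis (no_types, lifting))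
  qed
  show ?thesis
  proof
    show "davis_act \<Gamma> h (davis_point \<Gamma> g t) \<subseteq> davis_point \<Gamma> (h \<otimes>\<^bsub>racg \<Gamma>\<^esub> g) t"
      unfolding davis_act_def davis_point_def using star[of "(g, t)" _ h] h g by auto
    show "davis_point \<Gamma> (h \<otimes>\<^bsub>racg \<Gamma>\<^esub> g) t \<subseteq> davis_act \<Gamma> h (davis_point \<Gamma> g t)"
    proof
      fix b assume "b \<in> davis_point \<Gamma> (h \<otimes>\<^bsub>racg \<Gamma>\<^esub> g) t"
      then have "((h \<otimes>\<^bsub>racg \<Gamma>\<^esub> g, t), b) \<in> ?R\<^sup>*" by (simp add: davis_point_def)
      from star[OF this, of "inv\<^bsub>racg \<Gamma>\<^esub> h"] h g
      have b: "(?f (inv\<^bsub>racg \<Gamma>\<^esub> h) (h \<otimes>\<^bsub>racg \<Gamma>\<^esub> g, t), ?f (inv\<^bsub>racg \<Gamma>\<^esub> h) b) \<in> ?R\<^sup>*"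
        "fst b \<in> carrier (racg \<Gamma>)" by auto
      have "inv\<^bsub>racg \<Gamma>\<^esub> h \<otimes>\<^bsub>racg \<Gamma>\<^esub> (h \<otimes>\<^bsub>racg \<Gamma>\<^esub> g) = g"
        using h g G.m_assoc[of "inv\<^bsub>racg \<Gamma>\<^esub> h" h g] by simp
      with b have "?f (inv\<^bsub>racg \<Gamma>\<^esub> h) b \<in> davis_point \<Gamma> g t" by (simp add: davis_point_def)
      moreover have "b = ?f h (?f (inv\<^bsub>racg \<Gamma>\<^esub> h) b)"
        using b(2) h G.m_assoc[of h "inv\<^bsub>racg \<Gamma>\<^esub> h" "fst b"] by (cases b) simp
      ultimately show "b \<in> davis_act \<Gamma> h (davis_point \<Gamma> g t)"
        unfolding davis_act_def by blast
    qed
  qed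
qed


section \<open>Ascending and descending links\<close>

definition is_lift ::
    "'v pair_pre_digraph \<Rightarrow> ('v davis_pt set \<Rightarrow> complex) \<Rightarrow> ('v davis_pt \<Rightarrow> real) \<Rightarrow> bool" where
  "is_lift \<Gamma> \<phi> \<psi> \<longleftrightarrow> continuous_map (complex_topology (davis_complex \<Gamma>)) euclideanreal \<psi> \<and>
     (\<forall>p\<in>complex_points (davis_complex \<Gamma>). circle_quotient (\<psi> p) = \<phi> (davis_proj \<Gamma> p))"

text \<open>
  Since \<open>racg_abel\<close> separates the vertices of a cube of the Davis complex, the cubes of the quotient
  are embedded.  A \<open>(d - 1)\<close>-simplex of the link of a \<open>0\<close>-cube \<open>x\<close> of the quotient is therefore
  given by a \<open>d\<close>-cube containing \<open>x\<close>, and faces of simplices correspond to inclusions of cubes.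
\<close>

definition ascending ::
    "'v pair_pre_digraph \<Rightarrow> ('v davis_pt \<Rightarrow> real) \<Rightarrow> 'v davis_pt set \<Rightarrow> nat \<Rightarrow> 'v davis_pt set set \<Rightarrow> bool" where
  "ascending \<Gamma> \<psi> x d Q \<longleftrightarrow>
     (\<exists>P\<in>cubes (davis_complex \<Gamma>) d. davis_proj \<Gamma> ` P = Q \<and>
        (\<exists>p\<in>P. davis_proj \<Gamma> p = x \<and> (\<forall>q\<in>P. \<psi> p \<le> \<psi> q)))"

definition descending ::
    "'v pair_pre_digraph \<Rightarrow> ('v davis_pt \<Rightarrow> real) \<Rightarrow> 'v davis_pt set \<Rightarrow> nat \<Rightarrow> 'v davis_pt set set \<Rightarrow> bool" where
  "descending \<Gamma> \<psi> x d Q \<longleftrightarrow>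
     (\<exists>P\<in>cubes (davis_complex \<Gamma>) d. davis_proj \<Gamma> ` P = Q \<and>
        (\<exists>p\<in>P. davis_proj \<Gamma> p = x \<and> (\<forall>q\<in>P. \<psi> q \<le> \<psi> p)))"

text \<open>The subgraph of the link of \<open>x\<close> whose vertices and edges are given by the \<open>1\<close>-cubes and the
  \<open>2\<close>-cubes at \<open>x\<close> that satisfy \<open>A 1\<close> and \<open>A 2\<close>.\<close>

definition link_subgraph ::
    "('v, 'p) chart set \<Rightarrow> 'p \<Rightarrow> (nat \<Rightarrow> 'p set \<Rightarrow> bool) \<Rightarrow> 'p set pair_pre_digraph" where
  "link_subgraph K x A =
     (let W = {e \<in> cubes K 1. x \<in> e \<and> A 1 e} in
      \<lparr>pverts = W,
       parcs = {(e, f). e \<in> W \<and> f \<in> W \<and> e \<noteq> f \<and>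
                  (\<exists>q\<in>cubes K 2. x \<in> q \<and> A 2 q \<and> e \<subseteq> q \<and> f \<subseteq> q)}\<rparr>)"

definition ascending_link ::
    "'v pair_pre_digraph \<Rightarrow> ('v davis_pt \<Rightarrow> real) \<Rightarrow> 'v davis_pt set \<Rightarrow> 'v davis_pt set set pair_pre_digraph" where
  "ascending_link \<Gamma> \<psi> x = link_subgraph (quotient_complex \<Gamma>) x (ascending \<Gamma> \<psi> x)"

definition descending_link ::
    "'v pair_pre_digraph \<Rightarrow> ('v davis_pt \<Rightarrow> real) \<Rightarrow> 'v davis_pt set \<Rightarrow> 'v davis_pt set set pair_pre_digraph" where
  "descending_link \<Gamma> \<psi> x = link_subgraph (quotient_complex \<Gamma>) x (descending \<Gamma> \<psi> x)"

end

theory Submission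
  imports Defs
begin

text \<open>
  The abelianization identifies the vertices of the quotient complex \<open>X\<close> with subsets \<open>A\<close> of the
  vertex set \<open>V\<close>, and an edge of \<open>X\<close> in the direction \<open>v\<close> joins \<open>A\<close> to \<open>A \<triangle> {v}\<close>.  Let \<open>S\<close> be a
  state in the legal orbit and give the vertex \<open>A\<close> the state \<open>S\<^sub>A\<close> obtained from \<open>S\<close> by performing the
  moves \<open>m\<^sub>v\<close> for all \<open>v \<in> A\<close>; it lies in the same orbit, so it is legal.  Orient the edge at \<open>A\<close> in
  the direction \<open>v\<close> away from \<open>A\<close> if and only if \<open>v \<in> S\<^sub>A\<close>.  The two conditions on a move are what
  this needs: as \<open>v \<in> m\<^sub>v\<close>, the two ends of an edge agree on its orientation, and as \<open>m\<^sub>u\<close> contains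
  no neighbour \<open>v\<close> of \<open>u\<close>, opposite edges of a square are parallel.

  Such an orientation determines a diagonal map.  Upstairs one obtains a height on the
  Coxeter group by counting, along a word, the edges crossed forwards minus those crossed backwards;
  the two conditions say that this count respects the defining relations
  (\<open>word_height_presented_eq\<close>).  The height extends to the cubes as a sum of signed coordinates, is
  compatible with the gluing (\<open>cube_height_flip\<close>), and changes by integers under the deck group, so
  that it descends to a map from \<open>X\<close> to the circle.  Any other lift of that map has the same
  differences on each cube, because it differs from the signed sum by a continuous integer-valued
  function (\<open>is_lift_on_cube\<close>).

  The cubes at the vertex \<open>A\<close> correspond to the sets \<open>C\<close> of pairwise commuting generators
  (\<open>quotient_cube_at_vertex\<close>, \<open>quotient_cube_inj\<close>).  Such a cube is ascending exactly when all its
  edges at \<open>A\<close> point away from \<open>A\<close>, that is, when \<open>C \<subseteq> S\<^sub>A\<close> (\<open>ascending_iff\<close>), and it is descending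
  exactly when \<open>C \<subseteq> V - S\<^sub>A\<close>.  Hence the ascending and descending links at \<open>A\<close> are copies of the
  subgraphs of the given graph induced by \<open>S\<^sub>A\<close> and by its complement, and both are nonempty and connected by
  legality.
\<close>

section \<open>The right-angled Coxeter group\<close>

lemma group_racg: "group (racg \<Gamma>)"
  by (simp add: racg_def group_presented_group)

lemma carrier_racg: "carrier (racg \<Gamma>) = word_class (pverts \<Gamma>) (racg_relations \<Gamma>) ` words (pverts \<Gamma>)"
  by (simp add: racg_def presented_group_def)

lemma racg_gen_closed: "v \<in> pverts \<Gamma> \<Longrightarrow> racg_gen \<Gamma> v \<in> carrier (racg \<Gamma>)"
  by (auto simp: racg_gen_def carrier_racg)

lemma racg_mult_closed:
  "g \<in> carrier (racg \<Gamma>) \<Longrightarrow> h \<in> carrier (racg \<Gamma>) \<Longrightarrow> g \<otimes>\<^bsub>racg \<Gamma>\<^esub> h \<in> carrier (racg \<Gamma>)"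
  using group_racg[of \<Gamma>] by (simp add: group.is_monoid monoid.m_closed)

lemma racg_abel_mult:
  assumes "g \<in> carrier (racg \<Gamma>)" "h \<in> carrier (racg \<Gamma>)"
  shows "racg_abel (g \<otimes>\<^bsub>racg \<Gamma>\<^esub> h) = sym_diff (racg_abel g) (racg_abel h)"
  using hom_mult[OF racg_abel_hom assms] by (simp add: Z2_power_def)

lemma racg_kernel_iff: "h \<in> racg_kernel \<Gamma> \<longleftrightarrow> h \<in> carrier (racg \<Gamma>) \<and> racg_abel h = {}"
  by (auto simp: racg_kernel_def kernel_def Z2_power_def)

lemma racg_abel_one: "racg_abel \<one>\<^bsub>racg \<Gamma>\<^esub> = {}"
  using racg_abel_word_class[of "[]" \<Gamma>]
  by (simp add: racg_def presented_group_def word_parity_Nil)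

lemma racg_abel_inv:
  assumes g: "g \<in> carrier (racg \<Gamma>)"
  shows "racg_abel (inv\<^bsub>racg \<Gamma>\<^esub> g) = racg_abel g"
proof -
  interpret G: group "racg \<Gamma>" by (rule group_racg)
  have "sym_diff (racg_abel (inv\<^bsub>racg \<Gamma>\<^esub> g)) (racg_abel g) = {}"
    using racg_abel_mult[OF G.inv_closed[OF g] g] g by (simp add: racg_abel_one)
  then show ?thesis by blast
qed

lemma racg_gen_mult:
  assumes "u \<in> pverts \<Gamma>" "v \<in> pverts \<Gamma>"
  shows "racg_gen \<Gamma> u \<otimes>\<^bsub>racg \<Gamma>\<^esub> racg_gen \<Gamma> v
    = word_class (pverts \<Gamma>) (racg_relations \<Gamma>) [(u, True), (v, True)]"
  using word_class_mult[of "[(u, True)]" "pverts \<Gamma>" "[(v, True)]" "racg_relations \<Gamma>"] assms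
  by (simp add: racg_def racg_gen_def)

text \<open>
  A permutation representation on three points, used to tell \<open>u v\<close> from \<open>v u\<close> when \<open>u\<close> and \<open>v\<close> are
  not adjacent.
\<close>

definition two_gen_perm :: "'v \<Rightarrow> 'v \<Rightarrow> 'v word \<Rightarrow> nat \<Rightarrow> nat" where
  "two_gen_perm u v w = foldr (\<lambda>l f.
     (if fst l = u then Transposition.transpose 0 1
      else if fst l = v then Transposition.transpose 1 2 else id) \<circ> f) w id"

lemma two_gen_perm_simps:
  "two_gen_perm u v [] = id"
  "two_gen_perm u v (l # w) =
     (if fst l = u then Transposition.transpose 0 1
      else if fst l = v then Transposition.transpose 1 2 else id) \<circ> two_gen_perm u v w"
  by (simp_all add: two_gen_perm_def)

lemma two_gen_perm_append: "two_gen_perm u v (w @ w') = two_gen_perm u v w \<circ> two_gen_perm u v w'"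
  by (induction w) (simp_all add: two_gen_perm_simps comp_assoc)

lemma two_gen_perm_cong:
  assumes "presented_eq (pverts \<Gamma>) (racg_relations \<Gamma>) w w'"
    and "(u, v) \<notin> parcs \<Gamma>" "(v, u) \<notin> parcs \<Gamma>"
  shows "two_gen_perm u v w = two_gen_perm u v w'"
  using assms(1)
proof (induction rule: presented_eq.induct)
  case (relation w w')
  then consider x where "w = [(x, True), (x, True)]" "w' = []"
    | x y where "w = [(x, True), (y, True)]" "w' = [(y, True), (x, True)]" "(x, y) \<in> parcs \<Gamma>"
    by (auto simp: racg_relations_def)
  then show ?case
    using assms(2,3) by cases (auto simp: two_gen_perm_simps)
qed (simp_all add: two_gen_perm_append two_gen_perm_simps)

text \<open>
  If \<open>u\<close> and \<open>v\<close> are not adjacent, the defining relations hold after sending \<open>u\<close> and \<open>v\<close> to two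
  overlapping transpositions and all other generators to the identity.  As these transpositions do
  not commute, neither do \<open>u\<close> and \<open>v\<close>.
\<close>

lemma commuting_gens_adjacent:
  assumes \<Gamma>: "pair_graph \<Gamma>" and C: "commuting_gens \<Gamma> C" "u \<in> C" "v \<in> C" "u \<noteq> v"
  shows "(u, v) \<in> parcs \<Gamma>"
proof (rule ccontr)
  assume uv: "(u, v) \<notin> parcs \<Gamma>"
  interpret pair_graph \<Gamma> by (rule \<Gamma>)
  have vu: "(v, u) \<notin> parcs \<Gamma>" using uv arcs_symmetric by blast
  have V: "u \<in> pverts \<Gamma>" "v \<in> pverts \<Gamma>" using C by (auto simp: commuting_gens_def)
  have "racg_gen \<Gamma> u \<otimes>\<^bsub>racg \<Gamma>\<^esub> racg_gen \<Gamma> v = racg_gen \<Gamma> v \<otimes>\<^bsub>racg \<Gamma>\<^esub> racg_gen \<Gamma> u"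
    using C by (auto simp: commuting_gens_def)
  then have "presented_eq (pverts \<Gamma>) (racg_relations \<Gamma>) [(u, True), (v, True)] [(v, True), (u, True)]"
    using V by (simp add: racg_gen_mult word_class_eq_iff)
  from two_gen_perm_cong[OF this uv vu] \<open>u \<noteq> v\<close>
  have "Transposition.transpose 0 1 \<circ> Transposition.transpose 1 2
      = Transposition.transpose 1 2 \<circ> Transposition.transpose 0 (1::nat)"
    by (simp add: two_gen_perm_simps)
  from fun_cong[OF this, of 0] show False by (simp add: Transposition.transpose_def)
qed

lemma commuting_gens_singleton: "v \<in> pverts \<Gamma> \<Longrightarrow> commuting_gens \<Gamma> {v}"
  by (simp add: commuting_gens_def)

lemma commuting_gens_edge:
  assumes "pair_graph \<Gamma>" "(u, v) \<in> parcs \<Gamma>"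
  shows "commuting_gens \<Gamma> {u, v}"
proof -
  interpret pair_graph \<Gamma> by fact
  have V: "u \<in> pverts \<Gamma>" "v \<in> pverts \<Gamma>" using assms(2) by (auto dest: wellformed')
  have "presented_eq (pverts \<Gamma>) (racg_relations \<Gamma>) [(u, True), (v, True)] [(v, True), (u, True)]"
    by (rule presented_eq.relation) (use V assms(2) in \<open>auto simp: racg_relations_def\<close>)
  then have "word_class (pverts \<Gamma>) (racg_relations \<Gamma>) [(u, True), (v, True)]
      = word_class (pverts \<Gamma>) (racg_relations \<Gamma>) [(v, True), (u, True)]"
    using V by (subst word_class_eq_iff) simp_all
  then show ?thesis
    using V by (auto simp: commuting_gens_def racg_gen_mult)
qed

lemma racg_gen_square:
  assumes "v \<in> pverts \<Gamma>"
  shows "racg_gen \<Gamma> v \<otimes>\<^bsub>racg \<Gamma>\<^esub> racg_gen \<Gamma> v = \<one>\<^bsub>racg \<Gamma>\<^esub>"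
proof -
  have "presented_eq (pverts \<Gamma>) (racg_relations \<Gamma>) [(v, True), (v, True)] []"
    by (rule presented_eq.relation) (use assms in \<open>auto simp: racg_relations_def\<close>)
  then have "word_class (pverts \<Gamma>) (racg_relations \<Gamma>) [(v, True), (v, True)]
      = word_class (pverts \<Gamma>) (racg_relations \<Gamma>) []"
    using assms by (subst word_class_eq_iff) simp_all
  then show ?thesis
    unfolding racg_gen_mult[OF assms assms] by (simp add: racg_def presented_group_def)
qed

lemma racg_flip:
  assumes "g \<in> carrier (racg \<Gamma>)" "v \<in> pverts \<Gamma>"
  shows "g \<otimes>\<^bsub>racg \<Gamma>\<^esub> racg_gen \<Gamma> v \<in> carrier (racg \<Gamma>)"
    and "racg_abel (g \<otimes>\<^bsub>racg \<Gamma>\<^esub> racg_gen \<Gamma> v) = sym_diff (racg_abel g) {v}"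
    and "g \<otimes>\<^bsub>racg \<Gamma>\<^esub> racg_gen \<Gamma> v \<otimes>\<^bsub>racg \<Gamma>\<^esub> racg_gen \<Gamma> v = g"
proof -
  interpret G: group "racg \<Gamma>" by (rule group_racg)
  note gen = racg_gen_closed[OF assms(2)]
  show "g \<otimes>\<^bsub>racg \<Gamma>\<^esub> racg_gen \<Gamma> v \<in> carrier (racg \<Gamma>)" using assms gen by simp
  show "racg_abel (g \<otimes>\<^bsub>racg \<Gamma>\<^esub> racg_gen \<Gamma> v) = sym_diff (racg_abel g) {v}"
    by (simp only: racg_abel_mult[OF assms(1) gen] racg_abel_gen[OF assms(2)])
  show "g \<otimes>\<^bsub>racg \<Gamma>\<^esub> racg_gen \<Gamma> v \<otimes>\<^bsub>racg \<Gamma>\<^esub> racg_gen \<Gamma> v = g"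
    using assms gen by (simp add: G.m_assoc racg_gen_square)
qed

section \<open>Points of the Davis complex and of its quotient\<close>

lemma mem_davis_point: "(g, t) \<in> davis_point \<Gamma> g t"
  by (simp add: davis_point_def)

text \<open>
  Functions on the Davis complex are defined on representing pairs; this and
  \<open>davis_proj_invariant\<close> reduce their being well defined to one flip and to one deck transformation.
\<close>

lemma davis_point_invariant:
  assumes "\<And>a b. (a, b) \<in> davis_flip \<Gamma> \<Longrightarrow> F a = F b" "b \<in> davis_point \<Gamma> g t"
  shows "F b = F (g, t)"
proof -
  have "((g, t), b) \<in> (davis_flip \<Gamma> \<union> (davis_flip \<Gamma>)\<inverse>)\<^sup>*"
    using assms(2) by (simp add: davis_point_def)
  then show ?thesis
  proof (induction rule: rtrancl_induct)
    case base
    show ?case by simp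
  next
    case (step y z)
    then have "F z = F y" using assms(1)[of y z] assms(1)[of z y] by auto
    then show ?case using step.IH by simp
  qed
qed

lemma davis_point_flip:
  assumes "g \<in> carrier (racg \<Gamma>)" "commuting_gens \<Gamma> C" "v \<in> C" "t \<in> unit_cube C"
  shows "davis_point \<Gamma> (g \<otimes>\<^bsub>racg \<Gamma>\<^esub> racg_gen \<Gamma> v) (t(v := 1 - t v)) = davis_point \<Gamma> g t"
proof -
  let ?R = "davis_flip \<Gamma> \<union> (davis_flip \<Gamma>)\<inverse>"
  let ?a = "(g, t)" and ?b = "(g \<otimes>\<^bsub>racg \<Gamma>\<^esub> racg_gen \<Gamma> v, t(v := 1 - t v))"
  have ab: "(?a, ?b) \<in> ?R" "(?b, ?a) \<in> ?R"
    using assms by (auto simp: davis_flip_def)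
  have "(?a, c) \<in> ?R\<^sup>* \<longleftrightarrow> (?b, c) \<in> ?R\<^sup>*" for c
    using ab by (meson converse_rtrancl_into_rtrancl)
  then show ?thesis by (simp add: davis_point_def Image_def)
qed

lemma unit_cube_flip: "v \<in> C \<Longrightarrow> t \<in> unit_cube C \<Longrightarrow> t(v := 1 - t v) \<in> unit_cube C"
  by (auto simp: unit_cube_def)

lemma davis_cube_flip:
  assumes "g \<in> carrier (racg \<Gamma>)" "commuting_gens \<Gamma> C" "v \<in> C"
  shows "davis_point \<Gamma> (g \<otimes>\<^bsub>racg \<Gamma>\<^esub> racg_gen \<Gamma> v) ` unit_cube C = davis_point \<Gamma> g ` unit_cube C"
proof
  show "davis_point \<Gamma> g ` unit_cube C \<subseteq> davis_point \<Gamma> (g \<otimes>\<^bsub>racg \<Gamma>\<^esub> racg_gen \<Gamma> v) ` unit_cube C"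
    using davis_point_flip[OF assms, symmetric] unit_cube_flip[OF assms(3)] by blast
  show "davis_point \<Gamma> (g \<otimes>\<^bsub>racg \<Gamma>\<^esub> racg_gen \<Gamma> v) ` unit_cube C \<subseteq> davis_point \<Gamma> g ` unit_cube C"
  proof
    fix p assume "p \<in> davis_point \<Gamma> (g \<otimes>\<^bsub>racg \<Gamma>\<^esub> racg_gen \<Gamma> v) ` unit_cube C"
    then obtain t where t: "t \<in> unit_cube C"
      "p = davis_point \<Gamma> (g \<otimes>\<^bsub>racg \<Gamma>\<^esub> racg_gen \<Gamma> v) t" by blast
    have "p = davis_point \<Gamma> g (t(v := 1 - t v))"
      using davis_point_flip[OF assms unit_cube_flip[OF assms(3) t(1)]] t(2) by simp
    then show "p \<in> davis_point \<Gamma> g ` unit_cube C"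
      using unit_cube_flip[OF assms(3) t(1)] by blast
  qed
qed

lemma davis_proj_point:
  assumes "g \<in> carrier (racg \<Gamma>)"
  shows "davis_proj \<Gamma> (davis_point \<Gamma> g t)
    = (\<lambda>h. davis_point \<Gamma> (h \<otimes>\<^bsub>racg \<Gamma>\<^esub> g) t) ` racg_kernel \<Gamma>"
  unfolding davis_proj_def
  by (rule image_cong) (simp_all add: racg_kernel_iff davis_act_point assms)

lemma mem_davis_proj_point:
  assumes "g \<in> carrier (racg \<Gamma>)"
  shows "(g, t) \<in> \<Union> (davis_proj \<Gamma> (davis_point \<Gamma> g t))"
proof -
  interpret G: group "racg \<Gamma>" by (rule group_racg)
  have "\<one>\<^bsub>racg \<Gamma>\<^esub> \<in> racg_kernel \<Gamma>" by (simp add: racg_kernel_iff racg_abel_one)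
  then show ?thesis
    using mem_davis_point[of g t \<Gamma>] assms by (force simp: davis_proj_point)
qed

lemma davis_proj_invariant:
  assumes "\<And>a b. (a, b) \<in> davis_flip \<Gamma> \<Longrightarrow> F a = F b"
    and "\<And>h. h \<in> racg_kernel \<Gamma> \<Longrightarrow> F (h \<otimes>\<^bsub>racg \<Gamma>\<^esub> g, t) = F (g, t)"
    and "g \<in> carrier (racg \<Gamma>)" "b \<in> \<Union> (davis_proj \<Gamma> (davis_point \<Gamma> g t))"
  shows "F b = F (g, t)"
proof -
  obtain h where h: "h \<in> racg_kernel \<Gamma>" "b \<in> davis_point \<Gamma> (h \<otimes>\<^bsub>racg \<Gamma>\<^esub> g) t"
    using assms(3,4) by (auto simp: davis_proj_point)
  have "F b = F (h \<otimes>\<^bsub>racg \<Gamma>\<^esub> g, t)"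
    using assms(1) h(2) by (rule davis_point_invariant)
  then show ?thesis using assms(2) h(1) by simp
qed

text \<open>
  If \<open>g\<close> and \<open>g'\<close> have the same abelianization then \<open>g' \<cdot> inv g\<close> lies in the kernel and carries the
  point at \<open>g\<close> to the point at \<open>g'\<close>.
\<close>

lemma davis_proj_eqI:
  assumes g: "g \<in> carrier (racg \<Gamma>)" "g' \<in> carrier (racg \<Gamma>)" and eq: "racg_abel g = racg_abel g'"
  shows "davis_proj \<Gamma> (davis_point \<Gamma> g t) = davis_proj \<Gamma> (davis_point \<Gamma> g' t)"
proof -
  interpret G: group "racg \<Gamma>" by (rule group_racg)
  have *: "davis_proj \<Gamma> (davis_point \<Gamma> g t) \<subseteq> davis_proj \<Gamma> (davis_point \<Gamma> g' t)"
    if g: "g \<in> carrier (racg \<Gamma>)" "g' \<in> carrier (racg \<Gamma>)" "racg_abel g = racg_abel g'" for g g'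
  proof
    fix p assume "p \<in> davis_proj \<Gamma> (davis_point \<Gamma> g t)"
    then obtain h where h: "h \<in> racg_kernel \<Gamma>" "p = davis_point \<Gamma> (h \<otimes>\<^bsub>racg \<Gamma>\<^esub> g) t"
      using g by (auto simp: davis_proj_point)
    let ?k = "h \<otimes>\<^bsub>racg \<Gamma>\<^esub> (g \<otimes>\<^bsub>racg \<Gamma>\<^esub> inv\<^bsub>racg \<Gamma>\<^esub> g')"
    have "?k \<in> racg_kernel \<Gamma>"
      using h g by (simp add: racg_kernel_iff racg_abel_mult racg_abel_inv)
    moreover have "?k \<otimes>\<^bsub>racg \<Gamma>\<^esub> g' = h \<otimes>\<^bsub>racg \<Gamma>\<^esub> g"
      using h g by (simp add: racg_kernel_iff G.m_assoc)
    ultimately show "p \<in> davis_proj \<Gamma> (davis_point \<Gamma> g' t)"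
      using h g by (metis davis_proj_point imageI)
  qed
  show ?thesis using *[OF g eq] *[OF g(2,1) eq[symmetric]] by blast
qed

text \<open>
  These are coordinates on the quotient complex that realise it as a subcomplex of the cube
  \<open>[0,1]\<^sup>V\<close>, with the vertex \<open>g\<close> at the corner given by its abelianization.  Reversing the axis \<open>v\<close>
  changes both \<open>t v\<close> and the membership of \<open>v\<close> in \<open>racg_abel g\<close>, and the two changes cancel.
\<close>

definition cube_coord :: "'v word set \<times> ('v \<Rightarrow> real) \<Rightarrow> 'v \<Rightarrow> real" where
  "cube_coord = (\<lambda>(g, t) v. if v \<in> racg_abel g then 1 - t v else t v)"

lemma cube_coord_flip: "(a, b) \<in> davis_flip \<Gamma> \<Longrightarrow> cube_coord a = cube_coord b"
  by (fastforce simp: davis_flip_def cube_coord_def racg_flip commuting_gens_def fun_eq_iff)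

lemma cube_coord_eq:
  assumes "g \<in> carrier (racg \<Gamma>)" "g' \<in> carrier (racg \<Gamma>)"
    and "davis_proj \<Gamma> (davis_point \<Gamma> g t) = davis_proj \<Gamma> (davis_point \<Gamma> g' t')"
  shows "cube_coord (g, t) = cube_coord (g', t')"
proof (rule davis_proj_invariant[of \<Gamma> cube_coord])
  show "(g, t) \<in> \<Union> (davis_proj \<Gamma> (davis_point \<Gamma> g' t'))"
    unfolding assms(3)[symmetric] by (rule mem_davis_proj_point[OF assms(1)])
  show "cube_coord (h \<otimes>\<^bsub>racg \<Gamma>\<^esub> g', t') = cube_coord (g', t')" if "h \<in> racg_kernel \<Gamma>" for h
    using that assms(2) by (simp add: cube_coord_def racg_kernel_iff racg_abel_mult)
qed (use assms cube_coord_flip in auto)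

text \<open>
  Any corner of a cube can be taken as its origin: flip the coordinates equal to one, in turn.
\<close>

lemma davis_corner_indicator:
  assumes "finite D" "D \<subseteq> C" "commuting_gens \<Gamma> C" "g \<in> carrier (racg \<Gamma>)"
  shows "\<exists>k\<in>carrier (racg \<Gamma>). davis_point \<Gamma> g ` unit_cube C = davis_point \<Gamma> k ` unit_cube C \<and>
    davis_point \<Gamma> g (indicator D) = davis_point \<Gamma> k (\<lambda>_. 0)"
  using assms(1,2,4)
proof (induction D arbitrary: g rule: finite_induct)
  case empty
  have "(indicator {} :: 'a \<Rightarrow> real) = (\<lambda>_. 0)" by auto
  then show ?case using empty by (intro bexI[of _ g]) simp_all
next
  case (insert v D)
  let ?g = "g \<otimes>\<^bsub>racg \<Gamma>\<^esub> racg_gen \<Gamma> v"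
  have v: "v \<in> C" "v \<in> pverts \<Gamma>" using insert.prems assms(3) by (auto simp: commuting_gens_def)
  have g: "?g \<in> carrier (racg \<Gamma>)" using racg_flip(1)[OF insert.prems(2) v(2)] .
  have t: "indicator (insert v D) \<in> unit_cube C"
    using insert.prems by (auto simp: unit_cube_def indicator_def)
  have "(indicator (insert v D))(v := 1 - indicator (insert v D) v) = (indicator D :: 'a \<Rightarrow> real)"
    using insert.hyps by (auto simp: indicator_def)
  then have "davis_point \<Gamma> g (indicator (insert v D)) = davis_point \<Gamma> ?g (indicator D)"
    using davis_point_flip[OF insert.prems(2) assms(3) v(1) t] by simp
  then show ?case
    using insert.IH[OF _ g] insert.prems davis_cube_flip[OF insert.prems(2) assms(3) v(1)] by simp
qed

lemma finite_commuting_gens: "pair_graph \<Gamma> \<Longrightarrow> commuting_gens \<Gamma> C \<Longrightarrow> finite C"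
  by (meson commuting_gens_def finite_subset pair_fin_digraph.pair_finite_verts
      pair_digraph_def pair_graph_def)

text \<open>
  A point of a cube that lies over a vertex of the quotient has coordinates zero or one, since
  \<open>cube_coord\<close> takes only these values there.  So it is a corner, and can be made the origin.
\<close>

lemma davis_corner:
  assumes \<Gamma>: "pair_graph \<Gamma>"
    and g: "g \<in> carrier (racg \<Gamma>)" "g' \<in> carrier (racg \<Gamma>)"
    and C: "commuting_gens \<Gamma> C" and t: "t \<in> unit_cube C"
    and eq: "davis_proj \<Gamma> (davis_point \<Gamma> g t) = davis_proj \<Gamma> (davis_point \<Gamma> g' (\<lambda>_. 0))"
  shows "\<exists>k\<in>carrier (racg \<Gamma>). racg_abel k = racg_abel g' \<and>
    davis_point \<Gamma> g ` unit_cube C = davis_point \<Gamma> k ` unit_cube C \<and>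
    davis_point \<Gamma> g t = davis_point \<Gamma> k (\<lambda>_. 0)"
proof -
  let ?D = "{v. t v = 1}"
  have D: "?D \<subseteq> C" using t by (force simp: unit_cube_def)
  have coord: "cube_coord (g, t) v = cube_coord (g', \<lambda>_. 0) v" for v
    using cube_coord_eq[OF g eq] by simp
  have "t v = indicator ?D v" for v
    using coord[of v] by (auto simp: cube_coord_def indicator_def split: if_splits)
  then have "t = indicator ?D" by (rule ext)
  with davis_corner_indicator[OF finite_subset[OF D finite_commuting_gens[OF \<Gamma> C]] D C g(1)]
  obtain k where k: "k \<in> carrier (racg \<Gamma>)"
    "davis_point \<Gamma> g ` unit_cube C = davis_point \<Gamma> k ` unit_cube C"
    "davis_point \<Gamma> g t = davis_point \<Gamma> k (\<lambda>_. 0)" by auto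
  have coord': "cube_coord (k, \<lambda>_. 0) v = cube_coord (g', \<lambda>_. 0) v" for v
    using cube_coord_eq[OF k(1) g(2)] eq k(3) by simp
  have "v \<in> racg_abel k \<longleftrightarrow> v \<in> racg_abel g'" for v
    using coord'[of v]
    by (cases "v \<in> racg_abel k"; cases "v \<in> racg_abel g'") (simp_all add: cube_coord_def)
  then have "racg_abel k = racg_abel g'" by blast
  then show ?thesis using k by blast
qed

abbreviation quotient_cube :: "'v pair_pre_digraph \<Rightarrow> 'v word set \<Rightarrow> 'v set \<Rightarrow> 'v davis_pt set set" where
  "quotient_cube \<Gamma> g C \<equiv> davis_proj \<Gamma> ` davis_point \<Gamma> g ` unit_cube C"

abbreviation quotient_vertex :: "'v pair_pre_digraph \<Rightarrow> 'v word set \<Rightarrow> 'v davis_pt set" where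
  "quotient_vertex \<Gamma> g \<equiv> davis_proj \<Gamma> (davis_point \<Gamma> g (\<lambda>_. 0))"

lemma cubes_davis_complex:
  "cubes (davis_complex \<Gamma>) d =
     {davis_point \<Gamma> g ` unit_cube C | g C. g \<in> carrier (racg \<Gamma>) \<and> commuting_gens \<Gamma> C \<and> card C = d}"
  unfolding cubes_def davis_complex_def by blast

lemma cubes_quotient_complex:
  "cubes (quotient_complex \<Gamma>) d =
     {quotient_cube \<Gamma> g C | g C. g \<in> carrier (racg \<Gamma>) \<and> commuting_gens \<Gamma> C \<and> card C = d}"
  (is "?L = ?R")
proof (intro equalityI subsetI)
  fix e assume "e \<in> ?L"
  then obtain g C where "g \<in> carrier (racg \<Gamma>)" "commuting_gens \<Gamma> C" "card C = d"
    "e = (davis_proj \<Gamma> \<circ> davis_point \<Gamma> g) ` unit_cube C"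
    unfolding cubes_def quotient_complex_def davis_complex_def by blast
  then show "e \<in> ?R" unfolding image_comp[symmetric] by blast
next
  fix e assume "e \<in> ?R"
  then obtain g C where "g \<in> carrier (racg \<Gamma>)" "commuting_gens \<Gamma> C" "card C = d"
    "e = (davis_proj \<Gamma> \<circ> davis_point \<Gamma> g) ` unit_cube C"
    unfolding image_comp by blast
  then show "e \<in> ?L"
    unfolding cubes_def quotient_complex_def davis_complex_def by blast
qed

lemma quotient_cube_eqI:
  assumes "g \<in> carrier (racg \<Gamma>)" "g' \<in> carrier (racg \<Gamma>)" "racg_abel g = racg_abel g'"
  shows "quotient_cube \<Gamma> g C = quotient_cube \<Gamma> g' C"
  unfolding image_image using davis_proj_eqI[OF assms] by simp

lemma quotient_cube_at_vertex:
  assumes "pair_graph \<Gamma>" "g \<in> carrier (racg \<Gamma>)"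
    and "e \<in> cubes (quotient_complex \<Gamma>) d" "quotient_vertex \<Gamma> g \<in> e"
  shows "\<exists>C. commuting_gens \<Gamma> C \<and> card C = d \<and> e = quotient_cube \<Gamma> g C"
proof -
  obtain g' C where C: "g' \<in> carrier (racg \<Gamma>)" "commuting_gens \<Gamma> C" "card C = d"
    "e = quotient_cube \<Gamma> g' C"
    using assms(3) unfolding cubes_quotient_complex by blast
  then obtain t where t: "t \<in> unit_cube C"
    "davis_proj \<Gamma> (davis_point \<Gamma> g' t) = quotient_vertex \<Gamma> g"
    using assms(4) by auto
  obtain k where "k \<in> carrier (racg \<Gamma>)" "racg_abel k = racg_abel g"
    "davis_point \<Gamma> g' ` unit_cube C = davis_point \<Gamma> k ` unit_cube C"
    using davis_corner[OF assms(1) C(1) assms(2) C(2) t] by blast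
  then have "e = quotient_cube \<Gamma> g C"
    using C(4) quotient_cube_eqI[of k \<Gamma> g C] assms(2) by simp
  then show ?thesis using C by blast
qed

lemma zero_cubes_quotient_complex:
  assumes "pair_graph \<Gamma>" "x \<in> zero_cubes (quotient_complex \<Gamma>)"
  obtains g where "g \<in> carrier (racg \<Gamma>)" "x = quotient_vertex \<Gamma> g"
proof -
  obtain g C where C: "g \<in> carrier (racg \<Gamma>)" "commuting_gens \<Gamma> C" "card C = 0"
    "{x} = quotient_cube \<Gamma> g C"
    using assms(2) unfolding zero_cubes_def cubes_quotient_complex by blast
  have "(\<lambda>_. 0) \<in> unit_cube C" by (simp add: unit_cube_def)
  then have "quotient_vertex \<Gamma> g \<in> {x}" unfolding C(4) by blast
  then show ?thesis using that C(1) by blast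
qed

text \<open>
  If \<open>v \<in> C\<close>, the cube of \<open>C\<close> contains the neighbour of its origin in the direction \<open>v\<close>, and if this
  point lies in the cube of \<open>D\<close> then comparing \<open>cube_coord\<close> shows that the cube of \<open>D\<close> extends in the
  direction \<open>v\<close>, too.
\<close>

lemma quotient_cube_subset:
  assumes "g \<in> carrier (racg \<Gamma>)" and "quotient_cube \<Gamma> g C \<subseteq> quotient_cube \<Gamma> g D"
  shows "C \<subseteq> D"
proof
  fix v assume "v \<in> C"
  then have "indicator {v} \<in> unit_cube C" by (auto simp: unit_cube_def indicator_def)
  then obtain t where t: "t \<in> unit_cube D"
    "davis_proj \<Gamma> (davis_point \<Gamma> g (indicator {v})) = davis_proj \<Gamma> (davis_point \<Gamma> g t)"
    using assms(2) by (auto simp: image_subset_iff image_iff)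
  have "cube_coord (g, indicator {v}) v = cube_coord (g, t) v"
    using cube_coord_eq[OF assms(1,1) t(2)] by simp
  then have "t v = 1" by (auto simp: cube_coord_def split: if_splits)
  then show "v \<in> D" using t(1) by (auto simp: unit_cube_def)
qed

lemma quotient_cube_inj:
  assumes "g \<in> carrier (racg \<Gamma>)" "quotient_cube \<Gamma> g C = quotient_cube \<Gamma> g D"
  shows "C = D"
  using quotient_cube_subset[OF assms(1), of C D] quotient_cube_subset[OF assms(1), of D C] assms(2)
  by simp

section \<open>Links\<close>

lemma mk_symmetric_adj:
  "(u, v) \<in> parcs (mk_symmetric G) \<longleftrightarrow> (u, v) \<in> arcs_ends G \<or> (v, u) \<in> arcs_ends G"
  by (auto simp: mk_symmetric_def arcs_ends_conv)

lemma connected_image: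
  assumes "graph_connected G" "verts H = f ` verts G"
    and arcs: "\<And>u v. (u, v) \<in> arcs_ends G \<Longrightarrow> (f u, f v) \<in> arcs_ends H"
  shows "graph_connected H"
proof -
  have arc: "(f u, f v) \<in> parcs (mk_symmetric H)" if "(u, v) \<in> parcs (mk_symmetric G)" for u v
    using that arcs unfolding mk_symmetric_adj by blast
  have reach: "(f u, f v) \<in> rtrancl_on (verts H) (parcs (mk_symmetric H))"
    if "(u, v) \<in> rtrancl_on (verts G) (parcs (mk_symmetric G))" for u v
    using that
  proof (induction rule: rtrancl_on_induct)
    case base
    then show ?case using assms(2) by simp
  next
    case (step y z)
    have "f z \<in> verts H" using step.hyps(4) assms(2) by simp
    with step.IH arc[OF step.hyps(2)] show ?case by (rule rtrancl_on_into_rtrancl_on)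
  qed
  show ?thesis
    using assms(1,2) reach
    by (auto simp: connected_def strongly_connected_def reachable_def mk_symmetric_def)
qed

text \<open>
  If the cubes at a vertex selected by \<open>P\<close> are those in directions from \<open>T\<close>, sending \<open>v\<close> to the
  edge in direction \<open>v\<close> maps the induced subgraph on \<open>T\<close> onto the link: adjacent \<open>u\<close> and \<open>v\<close>
  commute and so span a square.  A surjective graph homomorphism preserves connectedness.
\<close>

lemma link_connected:
  assumes \<Gamma>: "pair_graph \<Gamma>" and g: "g \<in> carrier (racg \<Gamma>)"
    and P: "\<And>C. commuting_gens \<Gamma> C \<Longrightarrow> P (card C) (quotient_cube \<Gamma> g C) \<longleftrightarrow> C \<subseteq> T"
    and T: "T \<subseteq> pverts \<Gamma>" "T \<noteq> {}" "graph_connected (induce_subgraph (with_proj \<Gamma>) T)"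
  defines "L \<equiv> link_subgraph (quotient_complex \<Gamma>) (quotient_vertex \<Gamma> g) P"
  shows "pverts L \<noteq> {} \<and> graph_connected (with_proj L)"
proof -
  interpret pair_graph \<Gamma> by (rule \<Gamma>)
  have cube: "quotient_cube \<Gamma> g C \<in> cubes (quotient_complex \<Gamma>) (card C)"
    "quotient_vertex \<Gamma> g \<in> quotient_cube \<Gamma> g C" if "commuting_gens \<Gamma> C" for C
  proof -
    show "quotient_cube \<Gamma> g C \<in> cubes (quotient_complex \<Gamma>) (card C)"
      using that g unfolding cubes_quotient_complex by blast
    have "(\<lambda>_. 0) \<in> unit_cube C" by (simp add: unit_cube_def)
    then show "quotient_vertex \<Gamma> g \<in> quotient_cube \<Gamma> g C" by blast
  qed
  have W: "pverts L = (\<lambda>v. quotient_cube \<Gamma> g {v}) ` T"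
  proof (intro equalityI subsetI)
    fix e assume "e \<in> pverts L"
    then have e: "e \<in> cubes (quotient_complex \<Gamma>) 1" "quotient_vertex \<Gamma> g \<in> e" "P 1 e"
      by (simp_all add: L_def link_subgraph_def Let_def)
    obtain C where C: "commuting_gens \<Gamma> C" "card C = 1" "e = quotient_cube \<Gamma> g C"
      using quotient_cube_at_vertex[OF \<Gamma> g e(1,2)] by blast
    then have "C \<subseteq> T" using P[OF C(1)] e(3) by simp
    moreover obtain v where "C = {v}" using C(2) by (auto simp: card_1_singleton_iff)
    ultimately show "e \<in> (\<lambda>v. quotient_cube \<Gamma> g {v}) ` T" using C(3) by blast
  next
    fix e assume "e \<in> (\<lambda>v. quotient_cube \<Gamma> g {v}) ` T"
    then obtain v where v: "v \<in> T" "e = quotient_cube \<Gamma> g {v}" by blast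
    then have c: "commuting_gens \<Gamma> {v}" using T(1) by (auto intro: commuting_gens_singleton)
    show "e \<in> pverts L"
      using cube[OF c] P[OF c] v by (simp add: L_def link_subgraph_def Let_def)
  qed
  have arc: "(quotient_cube \<Gamma> g {u}, quotient_cube \<Gamma> g {v}) \<in> parcs L"
    if uv: "(u, v) \<in> parcs \<Gamma>" "u \<in> T" "v \<in> T" for u v
  proof -
    have "u \<noteq> v" using uv(1) by (rule no_loops')
    then have ne: "quotient_cube \<Gamma> g {u} \<noteq> quotient_cube \<Gamma> g {v}" and card: "card {u, v} = 2"
      using quotient_cube_inj[OF g, of "{u}" "{v}"] by auto
    have c: "commuting_gens \<Gamma> {u, v}" by (rule commuting_gens_edge[OF \<Gamma> uv(1)])
    have sub: "quotient_cube \<Gamma> g {w} \<subseteq> quotient_cube \<Gamma> g {u, v}" if "w \<in> {u, v}" for w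
      using that by (intro image_mono) (auto simp: unit_cube_def)
    have q: "\<exists>q\<in>cubes (quotient_complex \<Gamma>) 2. quotient_vertex \<Gamma> g \<in> q \<and> P 2 q \<and>
        quotient_cube \<Gamma> g {u} \<subseteq> q \<and> quotient_cube \<Gamma> g {v} \<subseteq> q"
      using cube[OF c] P[OF c] uv sub[of u] sub[of v] unfolding card
      by (intro bexI[of _ "quotient_cube \<Gamma> g {u, v}"]) simp_all
    have "quotient_cube \<Gamma> g {u} \<in> pverts L" "quotient_cube \<Gamma> g {v} \<in> pverts L"
      using uv unfolding W by blast+
    then show ?thesis
      using ne q by (simp add: L_def link_subgraph_def Let_def)
  qed
  have "graph_connected (with_proj L)"
  proof (rule connected_image[OF T(3)])
    show "verts (with_proj L) = (\<lambda>v. quotient_cube \<Gamma> g {v}) ` verts (induce_subgraph (with_proj \<Gamma>) T)"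
      using W by simp
    fix u v assume "(u, v) \<in> arcs_ends (induce_subgraph (with_proj \<Gamma>) T)"
    then have "(u, v) \<in> parcs \<Gamma>" "u \<in> T" "v \<in> T"
      by (auto simp: arcs_ends_def arc_to_ends_def induce_subgraph_def)
    then show "(quotient_cube \<Gamma> g {u}, quotient_cube \<Gamma> g {v}) \<in> arcs_ends (with_proj L)"
      using arc by simp
  qed
  then show ?thesis using W T(2) by simp
qed

text \<open>
  On the cube with origin at the vertex, \<open>\<psi>\<close> is affine with slopes \<open>\<plusminus>1\<close>, so its minimum is at the
  origin exactly when all slopes are positive.  The definition of \<open>ascending\<close> lets the minimum sit
  at another corner of another cube over the given one; \<open>davis_corner\<close> and \<open>quotient_cube_inj\<close>
  reduce this to the same situation, at a vertex \<open>k\<close> with the abelianization of \<open>g\<close>.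
\<close>

lemma ascending_iff:
  assumes \<Gamma>: "pair_graph \<Gamma>" and g: "g \<in> carrier (racg \<Gamma>)"
    and s: "\<And>v. v \<in> pverts \<Gamma> \<Longrightarrow> s v = 1 \<or> s v = -1"
    and \<psi>: "\<And>k D t. k \<in> carrier (racg \<Gamma>) \<Longrightarrow> racg_abel k = racg_abel g \<Longrightarrow> commuting_gens \<Gamma> D \<Longrightarrow>
      t \<in> unit_cube D \<Longrightarrow>
      \<psi> (davis_point \<Gamma> k t) = \<psi> (davis_point \<Gamma> k (\<lambda>_. 0)) + (\<Sum>v\<in>D. s v * t v)"
    and C: "commuting_gens \<Gamma> C"
  shows "ascending \<Gamma> \<psi> (quotient_vertex \<Gamma> g) (card C) (quotient_cube \<Gamma> g C) \<longleftrightarrow>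
    C \<subseteq> {v \<in> pverts \<Gamma>. s v = (1 :: real)}"
proof
  assume "ascending \<Gamma> \<psi> (quotient_vertex \<Gamma> g) (card C) (quotient_cube \<Gamma> g C)"
  then obtain P p where P: "P \<in> cubes (davis_complex \<Gamma>) (card C)"
      "davis_proj \<Gamma> ` P = quotient_cube \<Gamma> g C"
      "p \<in> P" "davis_proj \<Gamma> p = quotient_vertex \<Gamma> g" "\<forall>q\<in>P. \<psi> p \<le> \<psi> q"
    unfolding ascending_def by (elim bexE conjE)
  obtain g' D where D: "g' \<in> carrier (racg \<Gamma>)" "commuting_gens \<Gamma> D"
      and PD: "P = davis_point \<Gamma> g' ` unit_cube D"
    using P(1) unfolding cubes_davis_complex by (elim CollectE exE conjE)
  obtain t where t: "p = davis_point \<Gamma> g' t" "t \<in> unit_cube D"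
    using P(3) unfolding PD by (rule imageE)
  obtain k where k: "k \<in> carrier (racg \<Gamma>)" "racg_abel k = racg_abel g"
    "davis_point \<Gamma> g' ` unit_cube D = davis_point \<Gamma> k ` unit_cube D"
    "davis_point \<Gamma> g' t = davis_point \<Gamma> k (\<lambda>_. 0)"
    using davis_corner[OF \<Gamma> D(1) g D(2) t(2)] P(4) unfolding t(1) by (elim meta_impE bexE conjE)
  have "quotient_cube \<Gamma> g D = quotient_cube \<Gamma> g C"
    using P(2) quotient_cube_eqI[OF k(1) g k(2), of D] unfolding PD k(3) by simp
  then have DC: "D = C" by (rule quotient_cube_inj[OF g])
  show "C \<subseteq> {v \<in> pverts \<Gamma>. s v = 1}"
  proof
    fix v assume v: "v \<in> C"
    let ?t = "indicator {v} :: _ \<Rightarrow> real"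
    have t': "?t \<in> unit_cube C" using v by (auto simp: unit_cube_def indicator_def)
    have "\<psi> (davis_point \<Gamma> k (\<lambda>_. 0)) \<le> \<psi> (davis_point \<Gamma> k ?t)"
    proof -
      have "P = davis_point \<Gamma> k ` unit_cube C" using PD k(3) DC by simp
      then have "davis_point \<Gamma> k ?t \<in> P" using imageI[OF t'] by simp
      with P(5) show ?thesis unfolding t(1) k(4) by (rule bspec)
    qed
    also have "\<dots> = \<psi> (davis_point \<Gamma> k (\<lambda>_. 0)) + s v"
      using \<psi>[OF k(1,2) C t'] v finite_commuting_gens[OF \<Gamma> C] 
      by (simp add: indicator_def if_distrib cong: if_cong)
    finally have "s v \<ge> 0" by simp
    moreover have "v \<in> pverts \<Gamma>" using v C by (auto simp: commuting_gens_def)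
    ultimately show "v \<in> {v \<in> pverts \<Gamma>. s v = 1}" using s[of v] by auto
  qed
next
  assume sub: "C \<subseteq> {v \<in> pverts \<Gamma>. s v = 1}"
  have "\<psi> (davis_point \<Gamma> g (\<lambda>_. 0)) \<le> \<psi> (davis_point \<Gamma> g t)" if t: "t \<in> unit_cube C" for t
  proof -
    have "(\<Sum>v\<in>C. s v * t v) \<ge> 0"
      using sub t by (intro sum_nonneg) (auto simp: unit_cube_def)
    then show ?thesis using \<psi>[OF g _ C t] by simp
  qed
  moreover have "(\<lambda>_. 0) \<in> unit_cube C" by (simp add: unit_cube_def)
  moreover have "davis_point \<Gamma> g ` unit_cube C \<in> cubes (davis_complex \<Gamma>) (card C)"
    using g C unfolding cubes_davis_complex by blast
  ultimately show "ascending \<Gamma> \<psi> (quotient_vertex \<Gamma> g) (card C) (quotient_cube \<Gamma> g C)"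
    unfolding ascending_def by blast
qed

lemma descending_eq_ascending: "descending \<Gamma> \<psi> x d Q = ascending \<Gamma> (\<lambda>p. - \<psi> p) x d Q"
  by (simp add: descending_def ascending_def)

section \<open>Continuity\<close>

lemma openin_complex_topology: "openin (complex_topology K) = complex_open K"
  unfolding complex_topology_def by (simp add: istopology_complex_open topology_inverse')

lemma topspace_complex_topology: "topspace (complex_topology K) = complex_points K"
proof -
  have "{t \<in> unit_cube C. \<kappa> t \<in> complex_points K} = unit_cube C" if "(C, \<kappa>) \<in> K" for C \<kappa>
    using that by (auto simp: complex_points_def)
  then have "complex_open K (complex_points K)" by (auto simp: complex_open_def)
  then show ?thesis
    by (auto simp: topspace_def openin_complex_topology complex_open_def)
qed

lemma continuous_map_complex_topology:
  fixes f :: "'p \<Rightarrow> real"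
  shows "continuous_map (complex_topology K) euclideanreal f \<longleftrightarrow>
    (\<forall>(C, \<kappa>)\<in>K. continuous_on (unit_cube C) (\<lambda>t. f (\<kappa> t)))"
proof -
  have *: "{t \<in> unit_cube C. \<kappa> t \<in> {p \<in> complex_points K. f p \<in> U}} =
      unit_cube C \<inter> (\<lambda>t. f (\<kappa> t)) -` U" if "(C, \<kappa>) \<in> K" for C \<kappa> U
    using that by (auto simp: complex_points_def)
  have "complex_open K {p \<in> complex_points K. f p \<in> U} \<longleftrightarrow>
      (\<forall>(C, \<kappa>)\<in>K. openin (top_of_set (unit_cube C)) (unit_cube C \<inter> (\<lambda>t. f (\<kappa> t)) -` U))" for U
    unfolding complex_open_def using * by (auto simp: split_beta)
  then show ?thesis
    unfolding continuous_map_def openin_complex_topology topspace_complex_topology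
      continuous_openin_preimage_eq
    by (auto simp: split_beta)
qed

lemma circle_quotient_eq_iff: "circle_quotient s = circle_quotient t \<longleftrightarrow> s - t \<in> \<int>"
proof -
  have "circle_quotient s = circle_quotient t \<longleftrightarrow> cis (2 * pi * (s - t)) = 1"
    unfolding circle_quotient_def by (simp add: right_diff_distrib flip: cis_divide)
  also have "\<dots> \<longleftrightarrow> cos (2 * pi * (s - t)) = 1"
    by (metis cis.simps(1) cis_zero complex_eq_iff cos_one_sin_zero cis.simps(2) one_complex.simps)
  also have "\<dots> \<longleftrightarrow> s - t \<in> \<int>"
    by (auto simp: cos_one_2pi_int Ints_def)
  finally show ?thesis .
qed

section \<open>Oriented edges, heights and diagonal maps\<close>

text \<open>
  The number of edges crossed forwards minus the number crossed backwards along the path in the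
  quotient that starts at the vertex \<open>A\<close> and follows the letters of the word.  A generator and its
  inverse lead along the same edge, so they count alike.
\<close>

fun word_height :: "('v set \<Rightarrow> 'v \<Rightarrow> real) \<Rightarrow> 'v set \<Rightarrow> 'v word \<Rightarrow> real" where
  "word_height \<sigma> A [] = 0"
| "word_height \<sigma> A (l # w) = \<sigma> A (fst l) + word_height \<sigma> (sym_diff A {fst l}) w"

lemma word_height_append:
  "word_height \<sigma> A (u @ w) = word_height \<sigma> A u + word_height \<sigma> (sym_diff A (word_parity u)) w"
proof (induction u arbitrary: A)
  case Nil
  show ?case by (simp add: word_parity_Nil)
next
  case (Cons l u)
  have "sym_diff (sym_diff A {fst l}) (word_parity u) = sym_diff A (word_parity (l # u))"
    unfolding word_parity_Cons by blast
  then show ?case by (simp only: append_Cons word_height.simps Cons.IH add.assoc)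
qed

text \<open>
  The sign \<open>\<sigma> A v\<close> is positive if the edge at the vertex \<open>A\<close> in the direction \<open>v\<close> points away from
  \<open>A\<close>.  The second axiom says that the two ends of an edge agree on its orientation, the third that
  opposite edges of a square are parallel.
\<close>

locale edge_orientation = pair_graph \<Gamma> for \<Gamma> :: "'v pair_pre_digraph" +
  fixes \<sigma> :: "'v set \<Rightarrow> 'v \<Rightarrow> real"
  assumes sign: "v \<in> pverts \<Gamma> \<Longrightarrow> \<sigma> A v = 1 \<or> \<sigma> A v = -1"
    and sign_same: "v \<in> pverts \<Gamma> \<Longrightarrow> \<sigma> (sym_diff A {v}) v = - \<sigma> A v"
    and sign_adjacent: "(u, v) \<in> parcs \<Gamma> \<Longrightarrow> \<sigma> (sym_diff A {u}) v = \<sigma> A v"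
begin

text \<open>
  The relation \<open>v v = 1\<close> and the cancellation of \<open>v\<close> against its inverse cross one edge forth and back, and \<open>u v = v u\<close> goes around a square whose
  opposite edges are parallel; neither changes the count.
\<close>

lemma word_height_presented_eq:
  assumes "presented_eq (pverts \<Gamma>) (racg_relations \<Gamma>) u w"
  shows "word_height \<sigma> A u = word_height \<sigma> A w"
  using assms
proof (induction arbitrary: A rule: presented_eq.induct)
  case (append u v u' v')
  then show ?case
    using word_parity_racg_eq[OF append.hyps(1)] by (simp add: word_height_append)
next
  case (cancel x b)
  then show ?case using sign_same[of x A] by simp
next
  case (relation u v)
  then consider x where "x \<in> pverts \<Gamma>" "u = [(x, True), (x, True)]" "v = []"
    | x y where "(x, y) \<in> parcs \<Gamma>" "u = [(x, True), (y, True)]" "v = [(y, True), (x, True)]"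
    by (auto simp: racg_relations_def)
  then show ?case
  proof cases
    case 1
    then show ?thesis using sign_same[of x A] by simp
  next
    case 2
    then show ?thesis
      using sign_adjacent[of x y A] sign_adjacent[OF arcs_symmetric, of x y A] by simp
  qed
qed simp_all

lemma word_height_Ints: "w \<in> words (pverts \<Gamma>) \<Longrightarrow> word_height \<sigma> A w \<in> \<int>"
proof (induction w arbitrary: A)
  case (Cons l w)
  then have "\<sigma> A (fst l) \<in> \<int>" using sign[of "fst l" A] by auto
  then show ?case using Cons by simp
qed simp

definition height :: "'v word set \<Rightarrow> real" where
  "height g = word_height \<sigma> {}
     (SOME w. w \<in> words (pverts \<Gamma>) \<and> g = word_class (pverts \<Gamma>) (racg_relations \<Gamma>) w)"

lemma height_word_class:
  assumes "w \<in> words (pverts \<Gamma>)"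
  shows "height (word_class (pverts \<Gamma>) (racg_relations \<Gamma>) w) = word_height \<sigma> {} w"
proof -
  let ?c = "word_class (pverts \<Gamma>) (racg_relations \<Gamma>)"
  let ?w = "SOME u. u \<in> words (pverts \<Gamma>) \<and> ?c w = ?c u"
  have "?w \<in> words (pverts \<Gamma>) \<and> ?c w = ?c ?w"
    by (rule someI[where P = "\<lambda>u. u \<in> words (pverts \<Gamma>) \<and> ?c w = ?c u"]) (use assms in simp)
  then have "presented_eq (pverts \<Gamma>) (racg_relations \<Gamma>) w ?w"
    using word_class_eq_iff[OF assms] by blast
  from word_height_presented_eq[OF this, of "{}"] show ?thesis unfolding height_def by simp
qed

lemma height_Ints:
  assumes "g \<in> carrier (racg \<Gamma>)"
  shows "height g \<in> \<int>"
proof -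
  obtain w where w: "w \<in> words (pverts \<Gamma>)" "g = word_class (pverts \<Gamma>) (racg_relations \<Gamma>) w"
    using assms by (auto simp: carrier_racg)
  show ?thesis unfolding w(2) height_word_class[OF w(1)] by (rule word_height_Ints[OF w(1)])
qed

lemma height_step:
  assumes g: "g \<in> carrier (racg \<Gamma>)" and v: "v \<in> pverts \<Gamma>"
  shows "height (g \<otimes>\<^bsub>racg \<Gamma>\<^esub> racg_gen \<Gamma> v) = height g + \<sigma> (racg_abel g) v"
proof -
  obtain w where w: "w \<in> words (pverts \<Gamma>)"
    "g = word_class (pverts \<Gamma>) (racg_relations \<Gamma>) w"
    using g by (auto simp: carrier_racg)
  have "g \<otimes>\<^bsub>racg \<Gamma>\<^esub> racg_gen \<Gamma> v = word_class (pverts \<Gamma>) (racg_relations \<Gamma>) (w @ [(v, True)])"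
    using word_class_mult[of w "pverts \<Gamma>" "[(v, True)]" "racg_relations \<Gamma>"] w v
    by (simp add: racg_def racg_gen_def)
  then show ?thesis
    using w v by (simp add: height_word_class racg_abel_word_class word_height_append)
qed

definition cube_height :: "'v word set \<times> ('v \<Rightarrow> real) \<Rightarrow> real" where
  "cube_height = (\<lambda>(g, t). height g + (\<Sum>v\<in>pverts \<Gamma>. \<sigma> (racg_abel g) v * t v))"

lemma cube_height_eq:
  assumes "commuting_gens \<Gamma> C" "t \<in> unit_cube C"
  shows "cube_height (g, t) = height g + (\<Sum>v\<in>C. \<sigma> (racg_abel g) v * t v)"
proof -
  have "C \<subseteq> pverts \<Gamma>" using assms(1) by (simp add: commuting_gens_def)
  then have "(\<Sum>v\<in>C. \<sigma> (racg_abel g) v * t v) = (\<Sum>v\<in>pverts \<Gamma>. \<sigma> (racg_abel g) v * t v)"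
    using assms(2) pair_finite_verts
    by (intro sum.mono_neutral_left) (auto simp: unit_cube_def)
  then show ?thesis by (simp add: cube_height_def)
qed

text \<open>
  Moving the origin from \<open>g\<close> to \<open>g v\<close> raises the height of the origin by \<open>\<sigma> v\<close> and replaces
  \<open>\<sigma> v * t v\<close> by \<open>- \<sigma> v * (1 - t v)\<close>, which is smaller by \<open>\<sigma> v\<close>; the slopes in the other directions
  of the cube stay the same because these directions are adjacent to \<open>v\<close>.
\<close>

lemma cube_height_flip:
  assumes "(a, b) \<in> davis_flip \<Gamma>"
  shows "cube_height a = cube_height b"
proof -
  obtain g t v C where a: "a = (g, t)"
      and b: "b = (g \<otimes>\<^bsub>racg \<Gamma>\<^esub> racg_gen \<Gamma> v, t(v := 1 - t v))"
      and g: "g \<in> carrier (racg \<Gamma>)" and C: "commuting_gens \<Gamma> C" "v \<in> C" and t: "t \<in> unit_cube C"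
    using assms unfolding davis_flip_def by blast
  have v: "v \<in> pverts \<Gamma>" using C by (auto simp: commuting_gens_def)
  have fin: "finite C" using finite_commuting_gens[OF pair_graph C(1)] .
  let ?A = "racg_abel g"
  have same: "\<sigma> (sym_diff ?A {v}) u * t u = \<sigma> ?A u * t u" if "u \<in> C - {v}" for u
    using sign_adjacent[OF commuting_gens_adjacent[OF pair_graph C(1), of v u]] that C(2) by auto
  have "(\<Sum>u\<in>C. \<sigma> (sym_diff ?A {v}) u * (t(v := 1 - t v)) u)
      = \<sigma> (sym_diff ?A {v}) v * (1 - t v) + (\<Sum>u\<in>C - {v}. \<sigma> (sym_diff ?A {v}) u * t u)"
    by (subst sum.remove[OF fin C(2)]) simp
  also have "\<dots> = - \<sigma> ?A v * (1 - t v) + (\<Sum>u\<in>C - {v}. \<sigma> ?A u * t u)"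
    unfolding sign_same[OF v] by (simp only: sum.cong[OF HOL.refl same])
  also have "\<dots> = - \<sigma> ?A v + (\<Sum>u\<in>C. \<sigma> ?A u * t u)"
    unfolding sum.remove[OF fin C(2), of "\<lambda>u. \<sigma> ?A u * t u"] by (simp add: algebra_simps)
  finally show ?thesis
    unfolding a b cube_height_eq[OF C(1) t] cube_height_eq[OF C(1) unit_cube_flip[OF C(2) t]]
      height_step[OF g v] racg_flip(2)[OF g v]
    by simp
qed

definition davis_height :: "'v davis_pt \<Rightarrow> real" where
  "davis_height p = the_elem (cube_height ` p)"

lemma davis_height_point: "davis_height (davis_point \<Gamma> g t) = cube_height (g, t)"
  unfolding davis_height_def
proof (rule the_elem_image_unique)
  show "davis_point \<Gamma> g t \<noteq> {}" using mem_davis_point[of g t \<Gamma>] by (metis empty_iff)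
qed (rule davis_point_invariant[OF cube_height_flip])

definition quotient_phase :: "'v davis_pt set \<Rightarrow> complex" where
  "quotient_phase y = the_elem ((\<lambda>a. circle_quotient (cube_height a)) ` \<Union> y)"

lemma quotient_phase_point:
  assumes g: "g \<in> carrier (racg \<Gamma>)"
  shows "quotient_phase (davis_proj \<Gamma> (davis_point \<Gamma> g t)) = circle_quotient (cube_height (g, t))"
proof -
  let ?F = "\<lambda>a. circle_quotient (cube_height a)"
  let ?Y = "\<Union> (davis_proj \<Gamma> (davis_point \<Gamma> g t))"
  have deck: "?F (h \<otimes>\<^bsub>racg \<Gamma>\<^esub> g, t) = ?F (g, t)" if "h \<in> racg_kernel \<Gamma>" for h
  proof -
    have h: "h \<in> carrier (racg \<Gamma>)" "racg_abel h = {}" using that by (simp_all add: racg_kernel_iff)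
    have "height (h \<otimes>\<^bsub>racg \<Gamma>\<^esub> g) - height g \<in> \<int>"
      using height_Ints racg_mult_closed[OF h(1) g] g by simp
    then show ?thesis
      using h g by (simp add: circle_quotient_eq_iff cube_height_def racg_abel_mult)
  qed
  have flip: "?F a = ?F b" if "(a, b) \<in> davis_flip \<Gamma>" for a b
    using cube_height_flip[OF that] by simp
  show ?thesis
    unfolding quotient_phase_def
  proof (rule the_elem_image_unique)
    show "?Y \<noteq> {}" using mem_davis_proj_point[OF g] by (metis empty_iff)
    show "?F b = ?F (g, t)" if "b \<in> ?Y" for b
      using flip deck g that by (rule davis_proj_invariant)
  qed
qed

lemma quotient_phase_cube:
  assumes "g \<in> carrier (racg \<Gamma>)" "commuting_gens \<Gamma> C" "t \<in> unit_cube C"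
  shows "quotient_phase (davis_proj \<Gamma> (davis_point \<Gamma> g t))
    = circle_quotient (\<Sum>v\<in>C. \<sigma> (racg_abel g) v * t v)"
  using height_Ints[OF assms(1)]
  by (simp add: quotient_phase_point[OF assms(1)] cube_height_eq[OF assms(2,3)] circle_quotient_eq_iff)

lemma diagonal_map_quotient_phase: "diagonal_map (quotient_complex \<Gamma>) quotient_phase"
  unfolding diagonal_map_def
proof (intro ballI, clarify)
  fix C \<kappa> assume "(C, \<kappa>) \<in> quotient_complex \<Gamma>"
  then obtain g where g: "\<kappa> = davis_proj \<Gamma> \<circ> davis_point \<Gamma> g" "g \<in> carrier (racg \<Gamma>)"
    "commuting_gens \<Gamma> C"
    unfolding quotient_complex_def davis_complex_def by blast
  have "\<forall>v\<in>C. \<sigma> (racg_abel g) v = 1 \<or> \<sigma> (racg_abel g) v = -1"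
    using sign g(3) by (auto simp: commuting_gens_def)
  then show "\<exists>\<sigma>. (\<forall>v\<in>C. \<sigma> v = 1 \<or> \<sigma> v = -1) \<and>
      (\<forall>t\<in>unit_cube C. quotient_phase (\<kappa> t) = circle_quotient (\<Sum>v\<in>C. \<sigma> v * t v))"
    using quotient_phase_cube[OF g(2,3)] unfolding g(1)
    by (intro exI[of _ "\<sigma> (racg_abel g)"]) simp
qed

lemma is_lift_davis_height: "is_lift \<Gamma> quotient_phase davis_height"
  unfolding is_lift_def
proof
  show "continuous_map (complex_topology (davis_complex \<Gamma>)) euclideanreal davis_height"
    unfolding continuous_map_complex_topology davis_complex_def
  proof (intro ballI, clarify)
    fix C g
    have "continuous_on (unit_cube C) (\<lambda>t. height g + (\<Sum>v\<in>pverts \<Gamma>. \<sigma> (racg_abel g) v * t v))"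
      by (intro continuous_intros continuous_on_subset[OF continuous_on_product_coordinates subset_UNIV])
    then show "continuous_on (unit_cube C) (\<lambda>t. davis_height (davis_point \<Gamma> g t))"
      by (simp add: davis_height_point cube_height_def)
  qed
  show "\<forall>p\<in>complex_points (davis_complex \<Gamma>).
      circle_quotient (davis_height p) = quotient_phase (davis_proj \<Gamma> p)"
    by (auto simp: complex_points_def davis_complex_def davis_height_point quotient_phase_point)
qed

text \<open>
  Along the segment from the origin of the cube to \<open>t\<close>, the lift minus the signed sum of the
  coordinates is continuous and takes integer values, hence is constant.
\<close>

lemma is_lift_on_cube:
  assumes \<psi>: "is_lift \<Gamma> quotient_phase \<psi>"
    and g: "g \<in> carrier (racg \<Gamma>)" and C: "commuting_gens \<Gamma> C" and t: "t \<in> unit_cube C"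
  shows "\<psi> (davis_point \<Gamma> g t)
    = \<psi> (davis_point \<Gamma> g (\<lambda>_. 0)) + (\<Sum>v\<in>C. \<sigma> (racg_abel g) v * t v)"
proof -
  let ?L = "\<Sum>v\<in>C. \<sigma> (racg_abel g) v * t v"
  let ?c = "\<lambda>s v. s * t v"
  let ?f = "\<lambda>s. \<psi> (davis_point \<Gamma> g (?c s)) - s * ?L"
  have chart: "(C, davis_point \<Gamma> g) \<in> davis_complex \<Gamma>"
    using g C by (auto simp: davis_complex_def)
  have seg: "?c s \<in> unit_cube C" if "s \<in> {0..1}" for s
    using t that by (auto simp: unit_cube_def mult_le_one)
  have "continuous_on (unit_cube C) (\<lambda>t. \<psi> (davis_point \<Gamma> g t))"
    using \<psi> chart unfolding is_lift_def continuous_map_complex_topology by blast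
  moreover have "continuous_on {0..1} ?c"
    by (intro continuous_on_coordinatewise_then_product continuous_intros)
  ultimately have "continuous_on {0..1} (\<lambda>s. \<psi> (davis_point \<Gamma> g (?c s)))"
    by (rule continuous_on_compose2) (use seg in blast)
  then have cont: "continuous_on {0..1} ?f" by (intro continuous_intros)
  have int: "?f s \<in> \<int>" if s: "s \<in> {0..1}" for s
  proof -
    have "davis_point \<Gamma> g (?c s) \<in> complex_points (davis_complex \<Gamma>)"
      using chart seg[OF s] unfolding complex_points_def by blast
    then have "circle_quotient (\<psi> (davis_point \<Gamma> g (?c s)))
        = circle_quotient (\<Sum>v\<in>C. \<sigma> (racg_abel g) v * (s * t v))"
      using \<psi> quotient_phase_cube[OF g C seg[OF s]] by (simp add: is_lift_def)
    moreover have "(\<Sum>v\<in>C. \<sigma> (racg_abel g) v * (s * t v)) = s * ?L"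
      by (simp add: sum_distrib_left algebra_simps)
    ultimately show ?thesis by (simp add: circle_quotient_eq_iff)
  qed
  have "?f constant_on {0..1}"
  proof (rule continuous_discrete_range_constant[OF _ cont])
    fix s :: real assume s: "s \<in> {0..1}"
    have "1 \<le> norm (?f s' - ?f s)" if "s' \<in> {0..1}" "?f s' \<noteq> ?f s" for s'
      unfolding real_norm_def
      by (rule Ints_nonzero_abs_ge1) (use int[OF s] int[OF that(1)] that(2) in auto)
    then show "\<exists>e>0. \<forall>s'. s' \<in> {0..1} \<and> ?f s' \<noteq> ?f s \<longrightarrow> e \<le> norm (?f s' - ?f s)"
      by (intro exI[of _ 1]) simp
  qed simp
  then obtain c where c: "\<And>s. s \<in> {0..1} \<Longrightarrow> ?f s = c"
    unfolding constant_on_def by blast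
  have "?f 1 = ?f 0" using c[of 1] c[of 0] by simp
  then show ?thesis by simp
qed

lemma lift_links_connected:
  assumes \<psi>: "is_lift \<Gamma> quotient_phase \<psi>" and g: "g \<in> carrier (racg \<Gamma>)"
    and out: "{v \<in> pverts \<Gamma>. \<sigma> (racg_abel g) v = 1} = S" "S \<noteq> {}"
      "graph_connected (induce_subgraph (with_proj \<Gamma>) S)"
    and inw: "{v \<in> pverts \<Gamma>. \<sigma> (racg_abel g) v = -1} = T" "T \<noteq> {}"
      "graph_connected (induce_subgraph (with_proj \<Gamma>) T)"
  defines "x \<equiv> quotient_vertex \<Gamma> g"
  shows "pverts (ascending_link \<Gamma> \<psi> x) \<noteq> {} \<and> graph_connected (with_proj (ascending_link \<Gamma> \<psi> x)) \<and>
    pverts (descending_link \<Gamma> \<psi> x) \<noteq> {} \<and> graph_connected (with_proj (descending_link \<Gamma> \<psi> x))"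
proof -
  have up: "\<psi> (davis_point \<Gamma> k t)
      = \<psi> (davis_point \<Gamma> k (\<lambda>_. 0)) + (\<Sum>v\<in>D. \<sigma> (racg_abel g) v * t v)"
    if "k \<in> carrier (racg \<Gamma>)" "racg_abel k = racg_abel g" "commuting_gens \<Gamma> D" "t \<in> unit_cube D"
    for k D t
    using is_lift_on_cube[OF \<psi> that(1,3,4)] unfolding that(2) .
  have down: "- \<psi> (davis_point \<Gamma> k t)
      = - \<psi> (davis_point \<Gamma> k (\<lambda>_. 0)) + (\<Sum>v\<in>D. - \<sigma> (racg_abel g) v * t v)"
    if "k \<in> carrier (racg \<Gamma>)" "racg_abel k = racg_abel g" "commuting_gens \<Gamma> D" "t \<in> unit_cube D"
    for k D t
    using up[OF that] by (simp add: sum_negf)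
  have S: "S \<subseteq> pverts \<Gamma>" and T: "T \<subseteq> pverts \<Gamma>" using out(1) inw(1) by blast+
  have "ascending \<Gamma> \<psi> x (card C) (quotient_cube \<Gamma> g C) \<longleftrightarrow> C \<subseteq> S"
    if "commuting_gens \<Gamma> C" for C
    using ascending_iff[where s = "\<sigma> (racg_abel g)", OF pair_graph g sign up that]
    unfolding x_def out(1) .
  then have "pverts (ascending_link \<Gamma> \<psi> x) \<noteq> {} \<and> graph_connected (with_proj (ascending_link \<Gamma> \<psi> x))"
    unfolding ascending_link_def x_def by (intro link_connected[OF pair_graph g _ S out(2,3)])
  moreover have "descending \<Gamma> \<psi> x (card C) (quotient_cube \<Gamma> g C) \<longleftrightarrow> C \<subseteq> T"
    if "commuting_gens \<Gamma> C" for C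
  proof -
    have "- \<sigma> (racg_abel g) v = 1 \<or> - \<sigma> (racg_abel g) v = - 1" if "v \<in> pverts \<Gamma>" for v
      using sign[OF that, of "racg_abel g"] by auto
    note iff = ascending_iff[where s = "\<lambda>v. - \<sigma> (racg_abel g) v" and \<psi> = "\<lambda>p. - \<psi> p",
        OF pair_graph g this down that]
    have neg: "- r = 1 \<longleftrightarrow> r = -1" for r :: real by linarith
    show ?thesis
      using iff unfolding neg inw(1) x_def descending_eq_ascending .
  qed
  then have "pverts (descending_link \<Gamma> \<psi> x) \<noteq> {} \<and> graph_connected (with_proj (descending_link \<Gamma> \<psi> x))"
    unfolding descending_link_def x_def by (intro link_connected[OF pair_graph g _ T inw(2,3)])
  ultimately show ?thesis by blast
qed

end

section \<open>The orientation given by a system of moves\<close>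

text \<open>
  The sum of the moves \<open>m v\<close> over \<open>v \<in> B\<close> in \<open>Z2_power\<close>.
\<close>

definition move_sum :: "('v \<Rightarrow> 'v set) \<Rightarrow> 'v set \<Rightarrow> 'v set" where
  "move_sum m B = {x. odd (card {v \<in> B. x \<in> m v})}"

lemma move_sum_insert:
  assumes "finite B" "v \<notin> B"
  shows "move_sum m (insert v B) = sym_diff (move_sum m B) (m v)"
proof -
  have *: "{u \<in> insert v B. x \<in> m u} = (if x \<in> m v then insert v {u \<in> B. x \<in> m u} else {u \<in> B. x \<in> m u})"
    for x by auto
  show ?thesis unfolding move_sum_def * using assms by auto
qed

lemma move_sum_sym_diff:
  assumes "finite B"
  shows "move_sum m (sym_diff B {v}) = sym_diff (move_sum m B) (m v)"
proof (cases "v \<in> B")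
  case True
  then have "sym_diff B {v} = B - {v}" by blast
  moreover have "move_sum m B = sym_diff (move_sum m (B - {v})) (m v)"
    using move_sum_insert[of "B - {v}" v m] assms True by (simp add: insert_absorb)
  ultimately show ?thesis by auto
next
  case False
  then have "sym_diff B {v} = insert v B" by blast
  then show ?thesis using move_sum_insert[OF assms False] by simp
qed

lemma move_sum_in_move_group:
  assumes "finite B" "B \<subseteq> pverts \<Gamma>"
  shows "move_sum m B \<in> move_group \<Gamma> m"
  using assms
proof (induction B rule: finite_induct)
  case empty
  have "move_sum m {} = \<one>\<^bsub>Z2_power (pverts \<Gamma>)\<^esub>" by (simp add: move_sum_def Z2_power_def)
  then show ?case unfolding move_group_def using generate.one by simp
next
  case (insert v B)
  have "move_sum m B \<otimes>\<^bsub>Z2_power (pverts \<Gamma>)\<^esub> m v \<in> move_group \<Gamma> m"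
    using insert unfolding move_group_def by (intro generate.eng[OF _ generate.incl]) auto
  then show ?case using insert.hyps by (simp add: move_sum_insert Z2_power_def)
qed

text \<open>
  The vertices of the quotient are the subsets of \<open>pverts \<Gamma>\<close>; the intersection makes the sum of moves
  finite for every \<open>A\<close>, so that toggling \<open>v\<close> in \<open>A\<close> always performs the move at \<open>v\<close>.
\<close>

definition state_at :: "'v pair_pre_digraph \<Rightarrow> ('v \<Rightarrow> 'v set) \<Rightarrow> 'v set \<Rightarrow> 'v set \<Rightarrow> 'v set" where
  "state_at \<Gamma> m S A = sym_diff (move_sum m (A \<inter> pverts \<Gamma>)) S"

lemma state_at_in_orbit:
  assumes "pair_graph \<Gamma>"
  shows "state_at \<Gamma> m S A \<in> state_orbit \<Gamma> m S"
proof -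
  interpret pair_graph \<Gamma> by fact
  have "move_sum m (A \<inter> pverts \<Gamma>) \<in> move_group \<Gamma> m"
    by (rule move_sum_in_move_group) (use pair_finite_verts in auto)
  then show ?thesis unfolding state_orbit_def state_at_def by (rule imageI)
qed

lemma state_at_move:
  assumes "pair_graph \<Gamma>" "v \<in> pverts \<Gamma>"
  shows "state_at \<Gamma> m S (sym_diff A {v}) = sym_diff (state_at \<Gamma> m S A) (m v)"
proof -
  interpret pair_graph \<Gamma> by fact
  have "sym_diff A {v} \<inter> pverts \<Gamma> = sym_diff (A \<inter> pverts \<Gamma>) {v}" using assms(2) by blast
  moreover have "finite (A \<inter> pverts \<Gamma>)" using pair_finite_verts by blast
  ultimately have "move_sum m (sym_diff A {v} \<inter> pverts \<Gamma>) = sym_diff (move_sum m (A \<inter> pverts \<Gamma>)) (m v)"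
    by (simp only: move_sum_sym_diff)
  then show ?thesis unfolding state_at_def by blast
qed

lemma edge_orientation_state:
  assumes "pair_graph \<Gamma>" "system_of_moves \<Gamma> m"
  shows "edge_orientation \<Gamma> (\<lambda>A v. if v \<in> state_at \<Gamma> m S A then 1 else -1)"
proof -
  interpret pair_graph \<Gamma> by fact
  have self: "v \<in> m v" if "v \<in> pverts \<Gamma>" for v
    using assms(2) that by (simp add: system_of_moves_def is_move_def)
  have adj: "v \<notin> m u" if "(u, v) \<in> parcs \<Gamma>" for u v
    using assms(2) that arcs_symmetric[OF that] in_arcsD1[OF that]
    by (auto simp: system_of_moves_def is_move_def)
  show ?thesis
  proof unfold_locales
    fix A v assume v: "v \<in> pverts \<Gamma>"
    show "(if v \<in> state_at \<Gamma> m S (sym_diff A {v}) then 1 else - 1)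
        = - (if v \<in> state_at \<Gamma> m S A then 1 else - 1 :: real)"
      unfolding state_at_move[OF assms(1) v] using self[OF v] by auto
  next
    fix A u v assume uv: "(u, v) \<in> parcs \<Gamma>"
    show "(if v \<in> state_at \<Gamma> m S (sym_diff A {u}) then 1 else - 1)
        = (if v \<in> state_at \<Gamma> m S A then 1 else - 1 :: real)"
      unfolding state_at_move[OF assms(1) in_arcsD1[OF uv]] using adj[OF uv] by auto
  qed auto
qed

theorem theorem4p3:
  fixes \<Gamma> :: "'v pair_pre_digraph" and m :: "'v \<Rightarrow> 'v set"
  assumes "pair_graph \<Gamma>"
    and "system_of_moves \<Gamma> m"
    and "\<exists>Orb. legal_orbit \<Gamma> m Orb"
  shows "\<exists>\<phi>. diagonal_map (quotient_complex \<Gamma>) \<phi> \<and>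
    (\<exists>\<psi>. is_lift \<Gamma> \<phi> \<psi>) \<and>
    (\<forall>\<psi>. is_lift \<Gamma> \<phi> \<psi> \<longrightarrow>
      (\<forall>x\<in>zero_cubes (quotient_complex \<Gamma>).
        pverts (ascending_link \<Gamma> \<psi> x) \<noteq> {} \<and>
        graph_connected (with_proj (ascending_link \<Gamma> \<psi> x)) \<and>
        pverts (descending_link \<Gamma> \<psi> x) \<noteq> {} \<and>
        graph_connected (with_proj (descending_link \<Gamma> \<psi> x))))"
proof -
  obtain S where legal: "\<And>T. T \<in> state_orbit \<Gamma> m S \<Longrightarrow> legal_state \<Gamma> T"
    using assms(3) by (auto simp: legal_orbit_def)
  define \<sigma> :: "'v set \<Rightarrow> 'v \<Rightarrow> real"
    where "\<sigma> = (\<lambda>A v. if v \<in> state_at \<Gamma> m S A then 1 else -1)"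
  interpret edge_orientation \<Gamma> \<sigma>
    unfolding \<sigma>_def by (rule edge_orientation_state[OF assms(1,2)])
  have "pverts (ascending_link \<Gamma> \<psi> x) \<noteq> {} \<and> graph_connected (with_proj (ascending_link \<Gamma> \<psi> x)) \<and>
      pverts (descending_link \<Gamma> \<psi> x) \<noteq> {} \<and> graph_connected (with_proj (descending_link \<Gamma> \<psi> x))"
    if \<psi>: "is_lift \<Gamma> quotient_phase \<psi>" and x: "x \<in> zero_cubes (quotient_complex \<Gamma>)" for \<psi> x
  proof -
    obtain g where g: "g \<in> carrier (racg \<Gamma>)" "x = quotient_vertex \<Gamma> g"
      using zero_cubes_quotient_complex[OF assms(1) x] .
    let ?S = "state_at \<Gamma> m S (racg_abel g)"
    have S: "legal_state \<Gamma> ?S" by (rule legal[OF state_at_in_orbit[OF assms(1)]])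
    then have "{v \<in> pverts \<Gamma>. \<sigma> (racg_abel g) v = 1} = ?S"
      "{v \<in> pverts \<Gamma>. \<sigma> (racg_abel g) v = -1} = pverts \<Gamma> - ?S"
      by (auto simp: \<sigma>_def legal_state_def)
    then show ?thesis
      unfolding g(2) using S by (intro lift_links_connected[OF \<psi> g(1)]) (auto simp: legal_state_def)
  qed
  then show ?thesis
    using diagonal_map_quotient_phase is_lift_davis_height by blast
qed

end
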